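(* Let $\mathbb{F}_q$ be a finite field and let $m$ be a positive integer with $\gcd(m,q)=1$, with prime factorization $m=\ell_1^{e_1}\cdots\ell_s^{e_s}$, $\ell_1<\cdots<\ell_s$. Let $a(T),b(T)\in\mathbb{F}_q[T]$ be nonconstant monic polynomials, neither of which is an $\ell_i$-th power in $\mathbb{F}_q(T)$ for any $i=1,\dots,s$. Fix a power $q^k$ of $q$ and a congruence class $n_0+q^k\mathbb{Z}\in\mathbb{Z}/q^k\mathbb{Z}$. Then there is a constant $c=c(m,a,b,q^k)>0$ such that $$\deg\Big(\gcd\big(\Phi_m(a(T)^n),\Phi_m(b(T)^n)\big)\Big)\ge cn$$ for infinitely many positive integers $n\equiv n_0 \pmod{q^k}$.
   Context: $\Phi_m(x)$ denotes the $m$-th cyclotomic polynomial (with integer coefficients, reduced into $\mathbb{F}_q[x]$); the gcd is taken in $\mathbb{F}_q[T]$. *)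

theory Defs
  imports Complex_Main "HOL-Computational_Algebra.Polynomial" "HOL-Computational_Algebra.Fraction_Field"
    "HOL-Computational_Algebra.Polynomial_Factorial" "HOL-Number_Theory.Cong" "HOL-Library.Cardinality"
begin

definition cyclotomic_complex :: "nat \<Rightarrow> complex poly" where
  "cyclotomic_complex m =
     (\<Prod>k\<in>{k. k < m \<and> coprime k m}. [:- cis (2 * pi * real k / real m), 1:])"

text \<open>Its coefficients are integers; the integer cyclotomic polynomial Phi_m.\<close>
definition cyclotomic_int :: "nat \<Rightarrow> int poly" where
  "cyclotomic_int m = map_poly (\<lambda>z. round (Re z)) (cyclotomic_complex m)"

definition cyclotomic :: "nat \<Rightarrow> 'a::comm_ring_1 poly" where
  "cyclotomic m = map_poly of_int (cyclotomic_int m)"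

end

theory Submission
  imports
    "HOL-Algebra.Algebraic_Closure_Type"
    "HOL-Number_Theory.Residues"
    "HOL-Library.Nonpos_Ints"
    Defs
begin

text \<open>
  Let \<open>q\<close> be the order of the field, let \<open>Q\<close> be a power of \<open>q\<close> such that \<open>a\<close> and \<open>b\<close> split over
  \<open>GF(Q)\<close> and \<open>m\<close> divides \<open>Q - 1\<close>, and put \<open>n = t (Q^N - 1) / m\<close> with \<open>t\<close> bounded, prime to \<open>m\<close> and
  in a suitable class modulo \<open>q^k\<close>. An element \<open>\<theta>\<close> of \<open>GF(Q^N)\<close> is a common root of
  \<open>\<Phi>\<^sub>m(a^n)\<close> and \<open>\<Phi>\<^sub>m(b^n)\<close> as soon as the \<open>m\<close>-th power residue symbols of \<open>a(\<theta>)\<close> and \<open>b(\<theta>)\<close>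
  both have order \<open>m\<close>, so it suffices that for infinitely many \<open>N\<close> a positive proportion of the
  \<open>\<theta>\<close> have prescribed symbols \<open>\<zeta>^x\<close>, \<open>\<zeta>^y\<close> with \<open>x\<close>, \<open>y\<close> prime to \<open>m\<close>. Since \<open>a\<close> and \<open>b\<close> are not
  \<open>l\<close>-th powers for any prime \<open>l\<close> dividing \<open>m\<close>, such a pair exists that is orthogonal to every
  relation between the root multiplicities of \<open>a\<close> and \<open>b\<close>.

  By Fourier analysis this is a statement about the character sums \<open>S\<^sub>N\<close> of the characters
  attached to \<open>a^i b^j\<close>. The L-function \<open>L(u) = \<Sum>\<^sub>d A\<^sub>d u^d\<close> of a nontrivial character is a polynomial,
  and \<open>u L'(u) = L(u) \<Sum>\<^sub>N S\<^sub>N u^N\<close>. The product of the L-functions of all powers of the character has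
  a logarithmic derivative with nonnegative coefficients, so it is not a polynomial; hence no
  nontrivial factor vanishes at \<open>1 / Q\<close>. Summing the recurrence for \<open>S\<^sub>N\<close> then shows that
  \<open>\<Sum>\<^sub>N S\<^sub>N / Q^N\<close> has bounded partial sums, while the trivial characters contribute linearly.
\<close>

unbundle fps_syntax

section \<open>Power series with nonnegative logarithmic derivative\<close>

text \<open>Summing the normalised recurrence over d \<le> Y expresses the partial sum times the
  value of the polynomial at 1/q through boundedly many nonzero terms; that value is nonzero and can
  be divided out.\<close>

lemma recurrence_partial_sums_bounded:
  fixes A S :: "nat \<Rightarrow> complex" and q :: real
  assumes q: "q > 0"
    and A0: "\<And>d. d \<ge> s \<Longrightarrow> A d = 0"
    and S: "\<And>N. N \<ge> 1 \<Longrightarrow> norm (S N) \<le> q ^ N"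
    and rec: "\<And>d. of_nat d * A d = (\<Sum>N=1..d. S N * A (d - N))"
    and L: "(\<Sum>d<s. A d / of_real q ^ d) \<noteq> 0"
  shows "\<exists>C. \<forall>Y. norm (\<Sum>N=1..Y. S N / of_real q ^ N) \<le> C"
proof -
  define a where "a = (\<lambda>d. A d / of_real q ^ d)"
  define B where "B = (\<lambda>N. S N / of_real q ^ N)"
  define T where "T = (\<Sum>d<s. a d)"
  \<comment> \<open>\<open>R i\<close> is the tail of \<open>a\<close> beyond index
    \<open>i\<close>. It vanishes from \<open>s\<close> on, so only the last \<open>s\<close> values
    of \<open>N\<close> contribute to the error sum in \<open>key\<close>.\<close>
  define R where "R = (\<lambda>i. T - (\<Sum>j\<le>i. a j))"
  have a0: "a d = 0" if "d \<ge> s" for d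
    using A0[OF that] by (simp add: a_def)
  have T0: "T \<noteq> 0"
    using L by (simp add: T_def a_def)
  have B1: "norm (B N) \<le> 1" if "N \<ge> 1" for N
    using S[OF that] q by (simp add: B_def norm_divide norm_power divide_simps)
  have R0: "R i = 0" if "i \<ge> s" for i
  proof -
    have "(\<Sum>j\<le>i. a j) = (\<Sum>d<s. a d)"
      using that by (intro sum.mono_neutral_right) (auto intro: a0)
    thus ?thesis by (simp add: R_def T_def)
  qed
  have rec': "of_nat d * a d = (\<Sum>N=1..d. B N * a (d - N))" for d
  proof -
    have "of_nat d * a d = (\<Sum>N=1..d. S N * A (d - N)) / of_real q ^ d"
      unfolding rec[symmetric] by (simp add: a_def)
    also have "\<dots> = (\<Sum>N=1..d. B N * a (d - N))"
      unfolding sum_divide_distrib using q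
      by (intro sum.cong) (auto simp: B_def a_def power_diff)
    finally show ?thesis .
  qed
  have key: "(\<Sum>N=1..Y. B N) * T = (\<Sum>d\<le>Y. of_nat d * a d) + (\<Sum>N=1..Y. B N * R (Y - N))" for Y
  proof -
    have "(\<Sum>d\<le>Y. of_nat d * a d) = (\<Sum>d\<in>{..Y}. \<Sum>N\<in>{1..d}. B N * a (d - N))"
      by (simp add: rec')
    also have "\<dots> = (\<Sum>N\<in>{1..Y}. \<Sum>d\<in>{N..Y}. B N * a (d - N))"
      unfolding sum.Sigma[OF finite_atMost, simplified] sum.Sigma[OF finite_atLeastAtMost, simplified]
      by (subst (1 2) sum.Sigma, simp_all, rule sum.reindex_bij_witness[of _ "\<lambda>(x,y). (y,x)" "\<lambda>(x,y). (y,x)"]) auto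
    also have "\<dots> = (\<Sum>N\<in>{1..Y}. B N * (\<Sum>j\<le>Y - N. a j))"
    proof (intro sum.cong refl)
      fix N assume "N \<in> {1..Y}"
      thus "(\<Sum>d\<in>{N..Y}. B N * a (d - N)) = B N * (\<Sum>j\<le>Y - N. a j)"
        unfolding sum_distrib_left
        by (intro sum.reindex_bij_witness[of _ "\<lambda>j. j + N" "\<lambda>d. d - N"]) auto
    qed
    finally show ?thesis
      by (simp add: R_def sum_distrib_right sum_subtractf right_diff_distrib)
  qed
  define C where "C = ((\<Sum>d<s. norm (of_nat d * a d)) + (\<Sum>i<s. norm (R i))) / norm T"
  have "norm (\<Sum>N=1..Y. B N) \<le> C" for Y
  proof -
    have "norm (\<Sum>d\<le>Y. of_nat d * a d) \<le> (\<Sum>d\<le>Y. norm (of_nat d * a d))"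
      by (rule norm_sum)
    also have "\<dots> \<le> (\<Sum>d\<in>{..Y} \<union> {..<s}. norm (of_nat d * a d))"
      by (intro sum_mono2) auto
    also have "\<dots> = (\<Sum>d<s. norm (of_nat d * a d))"
      by (intro sum.mono_neutral_right) (auto intro: a0)
    finally have 1: "norm (\<Sum>d\<le>Y. of_nat d * a d) \<le> (\<Sum>d<s. norm (of_nat d * a d))" .
    have "norm (\<Sum>N=1..Y. B N * R (Y - N)) \<le> (\<Sum>N=1..Y. norm (R (Y - N)))"
      by (intro sum_norm_le) (auto simp: norm_mult intro!: mult_left_le_one_le B1)
    also have "\<dots> = (\<Sum>i<Y. norm (R i))"
      by (rule sum.reindex_bij_witness[of _ "\<lambda>i. Y - i" "\<lambda>i. Y - i"]) auto
    also have "\<dots> \<le> (\<Sum>i\<in>{..<Y} \<union> {..<s}. norm (R i))"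
      by (intro sum_mono2) auto
    also have "\<dots> = (\<Sum>i<s. norm (R i))"
      by (intro sum.mono_neutral_right) (auto intro: R0)
    finally have 2: "norm (\<Sum>N=1..Y. B N * R (Y - N)) \<le> (\<Sum>i<s. norm (R i))" .
    have "norm (\<Sum>N=1..Y. B N) * norm T \<le> (\<Sum>d<s. norm (of_nat d * a d)) + (\<Sum>i<s. norm (R i))"
      unfolding norm_mult[symmetric] key using norm_triangle_mono[OF 1 2] .
    thus ?thesis using T0 by (simp add: C_def field_simps)
  qed
  thus ?thesis unfolding B_def by blast
qed

text \<open>Comparing coefficients gives a recurrence for \<open>P\<close> without cancellation: all
  its coefficients are nonnegative and those at multiples of \<open>j\<close> are nonzero, so
  infinitely many are nonzero.\<close>

lemma fps_log_deriv_nonneg_not_poly: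
  fixes P S :: "complex fps"
  assumes ode: "fps_X * fps_deriv P = S * P" and P0: "P $ 0 = 1"
    and S: "\<And>n. S $ n \<in> \<real>\<^sub>\<ge>\<^sub>0" and j: "j > 0" "S $ j \<noteq> 0"
  shows "P \<noteq> fps_of_poly R"
proof -
  have S0: "S $ 0 = 0"
    using arg_cong[OF ode, of "\<lambda>f. f $ 0"] P0 by simp
  have rec: "of_nat n * P $ n = (\<Sum>i=0..n. S $ i * P $ (n - i))" for n
  proof -
    have "(fps_X * fps_deriv P) $ n = of_nat n * P $ n"
      by (cases n) simp_all
    thus ?thesis by (simp add: ode fps_mult_nth)
  qed
  have P: "P $ n \<in> \<real>\<^sub>\<ge>\<^sub>0" for n
  proof (induction n rule: less_induct)
    case (less n)
    show ?case
    proof (cases "n = 0")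
      case False
      \<comment> \<open>The term \<open>i = 0\<close> would involve \<open>P $ n\<close> itself, but
        \<open>S $ 0 = 0\<close> removes it.\<close>
      have "S $ i * P $ (n - i) \<in> \<real>\<^sub>\<ge>\<^sub>0" for i
        using less[of "n - i"] S[of i] False
        by (cases "i = 0") (auto simp: S0 intro!: nonneg_Reals_mult_I)
      hence "(\<Sum>i\<in>I. S $ i * P $ (n - i)) \<in> \<real>\<^sub>\<ge>\<^sub>0" for I
        by (induction I rule: infinite_finite_induct) (auto intro!: nonneg_Reals_add_I)
      moreover have "P $ n = (\<Sum>i=0..n. S $ i * P $ (n - i)) / of_nat n"
        using rec[of n] False by (simp add: field_simps)
      ultimately show ?thesis by simp
    qed (simp add: P0)
  qed
  have "P $ (j * k) \<noteq> 0" for k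
  proof (induction k)
    case (Suc k)
    define n where "n = j * Suc k"
    have "Re (S $ i * P $ (n - i)) \<ge> 0" for i
      using nonneg_Reals_mult_I[OF S[of i] P[of "n - i"]] by (auto simp: complex_nonneg_Reals_iff)
    hence "Re (S $ j * P $ (n - j)) \<le> (\<Sum>i=0..n. Re (S $ i * P $ (n - i)))"
      by (intro member_le_sum) (auto simp: n_def)
    moreover have "S $ j * P $ (n - j) \<noteq> 0" 
      using Suc j by (simp add: n_def)
    hence "Re (S $ j * P $ (n - j)) > 0"
      using nonneg_Reals_mult_I[OF S[of j] P[of "n - j"]]
      by (smt (verit) complex_eq_iff complex_nonneg_Reals_iff zero_complex.sel)
    ultimately have "Re (of_nat n * P $ n) > 0"
      unfolding rec Re_sum by linarith
    thus ?case unfolding n_def[symmetric] by auto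
  qed (use P0 in auto)
  hence "P $ (j * Suc (degree R)) \<noteq> 0" by blast
  moreover have "fps_of_poly R $ (j * Suc (degree R)) = 0"
    using mult_le_mono1[of 1 j "Suc (degree R)"] j by (auto intro!: coeff_eq_0)
  ultimately show ?thesis by metis
qed

lemma fps_log_deriv_prod:
  fixes L S :: "'b \<Rightarrow> 'a :: field_char_0 fps"
  assumes "finite I" and "\<And>t. t \<in> I \<Longrightarrow> fps_X * fps_deriv (L t) = S t * L t"
  shows "fps_X * fps_deriv (\<Prod>t\<in>I. L t) = (\<Sum>t\<in>I. S t) * (\<Prod>t\<in>I. L t)"
  using assms
proof (induction I rule: finite_induct)
  case (insert x I)
  have "fps_X * fps_deriv (\<Prod>t\<in>insert x I. L t) =
        (fps_X * fps_deriv (L x)) * (\<Prod>t\<in>I. L t) + L x * (fps_X * fps_deriv (\<Prod>t\<in>I. L t))"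
    using insert.hyps by (simp add: algebra_simps)
  also have "\<dots> = (\<Sum>t\<in>insert x I. S t) * (\<Prod>t\<in>insert x I. L t)"
    using insert by (simp add: algebra_simps)
  finally show ?case .
qed simp

text \<open>A zero of \<open>L 1\<close> at \<open>1 / q\<close> would cancel the pole of \<open>L k\<close> and turn the product of all
  \<open>L t\<close> into a polynomial.\<close>
lemma nonvanishing_of_nonneg_log_deriv:
  fixes L S :: "nat \<Rightarrow> complex fps" and p :: "nat \<Rightarrow> complex poly" and q :: complex
  assumes k: "k \<ge> 2"
    and ode: "\<And>t. t \<in> {1..k} \<Longrightarrow> fps_X * fps_deriv (L t) = S t * L t"
    and L0: "\<And>t. t \<in> {1..k} \<Longrightarrow> L t $ 0 = 1"
    and p: "\<And>t. t \<in> {1..<k} \<Longrightarrow> L t = fps_of_poly (p t)"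
    and r: "fps_of_poly [:1, -q:] * L k = fps_of_poly r"
    and S: "\<And>n. (\<Sum>t=1..k. S t $ n) \<in> \<real>\<^sub>\<ge>\<^sub>0" and j: "j > 0" "(\<Sum>t=1..k. S t $ j) \<noteq> 0"
    and q: "q \<noteq> 0"
  shows "poly (p 1) (1 / q) \<noteq> 0"
proof
  assume "poly (p 1) (1 / q) = 0"
  then obtain p' where p': "p 1 = [:- (1 / q), 1:] * p'"
    by (auto simp: poly_eq_0_iff_dvd)
  \<comment> \<open>The linear factor of the root 1/q is rewritten as a multiple of 1 - q X, the
    factor that turns \<open>L k\<close> into a polynomial.\<close>
  have "p 1 = smult (- (1 / q)) ([:1, -q:] * p')"
    unfolding p' using q by (simp add: smult_add_right)
  hence p1: "p 1 = [:1, -q:] * smult (- (1 / q)) p'"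
    by (metis mult_smult_right)
  define P where "P = (\<Prod>t\<in>{1..k}. L t)"
  define R where "R = smult (- (1 / q)) p' * r * (\<Prod>t\<in>{2..<k}. p t)"
  have "{1..k} = insert 1 (insert k {2..<k})"
    using k by auto
  hence "P = L 1 * L k * (\<Prod>t\<in>{2..<k}. L t)"
    using k by (simp add: P_def mult_ac)
  also have "(\<Prod>t\<in>{2..<k}. L t) = fps_of_poly (\<Prod>t\<in>{2..<k}. p t)"
    unfolding fps_of_poly_prod by (intro prod.cong) (auto simp: p)
  also have "L 1 = fps_of_poly [:1, -q:] * fps_of_poly (smult (- (1 / q)) p')"
    using p[of 1] k by (simp only: p1 fps_of_poly_mult) simp
  also have "\<dots> * L k = fps_of_poly (smult (- (1 / q)) p') * (fps_of_poly [:1, -q:] * L k)"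
    by (simp only: mult_ac)
  also note r
  finally have "P = fps_of_poly R"
    by (simp add: R_def fps_of_poly_mult)
  moreover have "P \<noteq> fps_of_poly R"
  proof (rule fps_log_deriv_nonneg_not_poly)
    show "fps_X * fps_deriv P = (\<Sum>t=1..k. S t) * P"
      unfolding P_def using ode by (intro fps_log_deriv_prod) auto
    have "P $ 0 = (\<Prod>t\<in>{1..k}. L t $ 0)"
      unfolding P_def by (induction rule: infinite_finite_induct) auto
    thus "P $ 0 = 1" using L0 by simp
    show "j > 0" by fact
    show "(\<Sum>t=1..k. S t) $ n \<in> \<real>\<^sub>\<ge>\<^sub>0" for n
      using S[of n] by (simp add: fps_sum_nth)
    show "(\<Sum>t=1..k. S t) $ j \<noteq> 0"
      using j by (simp add: fps_sum_nth)
  qed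
  ultimately show False by blast
qed

section \<open>Cyclotomic polynomials\<close>

locale coeff_hom =
  fixes h :: "'a :: comm_ring_1 \<Rightarrow> 'b :: comm_ring_1"
  assumes hom_one [simp]: "h 1 = 1"
    and hom_add: "h (x + y) = h x + h y"
    and hom_mult: "h (x * y) = h x * h y"
begin

lemma hom_zero [simp]: "h 0 = 0"
  using hom_add[of 0 0] by simp

lemma hom_sum: "h (sum f I) = (\<Sum>i\<in>I. h (f i))"
  by (induction I rule: infinite_finite_induct) (simp_all add: hom_add)

lemma hom_uminus: "h (- x) = - h x"
  using hom_add[of x "- x"] by (simp add: eq_neg_iff_add_eq_0 add.commute)

lemma hom_diff: "h (x - y) = h x - h y"
  using hom_add[of x "- y"] by (simp add: hom_uminus)

lemma coeff_map_hom [simp]: "coeff (map_poly h p) n = h (coeff p n)"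
  by (simp add: coeff_map_poly)

lemma map_poly_hom_add: "map_poly h (p + r) = map_poly h p + map_poly h r"
  by (intro poly_eqI) (simp add: hom_add)

lemma map_poly_hom_mult: "map_poly h (p * r) = map_poly h p * map_poly h r"
  by (intro poly_eqI) (simp add: coeff_mult hom_sum hom_mult)

lemma map_poly_hom_prod: "map_poly h (prod f I) = (\<Prod>i\<in>I. map_poly h (f i))"
  by (induction I rule: infinite_finite_induct) (simp_all add: map_poly_hom_mult)

lemma map_poly_hom_power: "map_poly h (p ^ n) = map_poly h p ^ n"
  by (induction n) (simp_all add: map_poly_hom_mult)

lemma map_poly_hom_pCons: "map_poly h (pCons c p) = pCons (h c) (map_poly h p)"
  by (intro poly_eqI) (simp add: coeff_pCons split: nat.split)

lemma poly_map_hom: "poly (map_poly h p) (h x) = h (poly p x)"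
  by (induction p) (simp_all add: map_poly_hom_pCons hom_add hom_mult)

lemma map_poly_hom_monic:
  assumes "lead_coeff p = 1"
  shows "degree (map_poly h p) = degree p" "lead_coeff (map_poly h p) = 1"
proof -
  show "degree (map_poly h p) = degree p"
    using assms by (intro map_poly_degree_eq) simp
  thus "lead_coeff (map_poly h p) = 1"
    using assms by simp
qed

lemma map_poly_hom_pcompose:
  "map_poly h (pcompose p r) = pcompose (map_poly h p) (map_poly h r)"
  by (induction p)
     (simp_all add: pcompose_pCons map_poly_hom_pCons map_poly_hom_add map_poly_hom_mult)

end

interpretation of_int_hom: coeff_hom "of_int :: int \<Rightarrow> 'a :: comm_ring_1"
  by standard auto

lemma lead_coeff_prod_monic:
  fixes f :: "'b \<Rightarrow> 'a :: idom poly"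
  assumes "\<And>x. x \<in> I \<Longrightarrow> lead_coeff (f x) = 1"
  shows "lead_coeff (\<Prod>x\<in>I. f x) = 1"
  using assms by (induction I rule: infinite_finite_induct) (simp_all add: lead_coeff_mult)

lemma degree_prod_linear:
  "degree (\<Prod>x\<in>I. [:- f x, 1:] :: 'a :: idom poly) = card I"
  by (subst degree_prod_eq_sum_degree) auto

lemma prod_cyclotomic_complex:
  assumes "m > 0"
  shows "(\<Prod>d | d dvd m. cyclotomic_complex d) = monom 1 m - 1"
proof -
  define R where "R = (\<lambda>k. cis (2 * pi * real k / real m))"
  have R: "bij_betw R {..<m} {z. z ^ m = 1}"
    unfolding R_def using bij_betw_roots_unity[OF assms] .
  have fin: "finite {d. d dvd m}"
    using assms by simp
  have deg: "degree (monom 1 m - 1 :: complex poly) = m"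
    unfolding diff_conv_add_uminus using assms
    by (subst degree_add_eq_left) (simp_all add: degree_monom_eq)
  have "(\<Prod>d | d dvd m. cyclotomic_complex d) =
        (\<Prod>(d, k)\<in>(SIGMA d:{d. d dvd m}. {k. k < d \<and> coprime k d}). [:- cis (2 * pi * real k / real d), 1:])"
    unfolding cyclotomic_complex_def by (subst prod.Sigma) (use fin in auto)
  also have "\<dots> = (\<Prod>k<m. [:- R k, 1:])"
  \<comment> \<open>The bijection reduces the fraction k/m to lowest terms; its inverse expands to
    the denominator \<open>m\<close>.\<close>
  proof (rule prod.reindex_bij_witness[of _ "\<lambda>k. (m div gcd k m, k div gcd k m)" "\<lambda>(d, k). k * (m div d)"], goal_cases)
    case (1 x)
    then obtain d k c where x: "x = (d, k)" "m = d * c" "coprime k d" "k < d"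
      by auto
    have "c > 0" "d > 0" using x assms by auto
    moreover have "gcd (k * c) (d * c) = c"
      using x by (simp add: gcd_mult_right coprime_iff_gcd_eq_1 gcd.commute)
    ultimately show ?case using x by auto
  next
    case (2 x)
    then obtain d k c where x: "x = (d, k)" "m = d * c" "coprime k d" "k < d"
      by auto
    thus ?case using assms by (auto intro!: mult_strict_right_mono)
  next
    case (3 k)
    show ?case using assms by (simp add: dvd_div_mult_self div_div_eq_right)
  next
    case (4 k)
    have "m div gcd k m dvd m"
      by (metis dvd_triv_left dvd_div_mult_self gcd_dvd2)
    thus ?case using 4 assms
      by (auto simp: div_less_mono intro!: div_gcd_coprime)
  next
    case (5 x)
    then obtain d k c where x: "x = (d, k)" "m = d * c" "coprime k d" "k < d"
      by auto
    thus ?case using assms by (simp add: R_def mult.assoc)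
  qed
  also have "\<dots> = monom 1 m - 1"
  proof (rule poly_eqI_degree_lead_coeff)
    show "card {z :: complex. z ^ m = 1} \<ge> m"
      using bij_betw_same_card[OF R] by simp
    have "lead_coeff (\<Prod>k<m. [:- R k, 1:]) = 1"
      by (rule lead_coeff_prod_monic) simp
    thus "coeff (\<Prod>k<m. [:- R k, 1:]) m = coeff (monom 1 m - 1) m"
      using assms by (simp add: degree_prod_linear)
    show "poly (\<Prod>k<m. [:- R k, 1:]) z = poly (monom 1 m - 1) z" if "z \<in> {z. z ^ m = 1}" for z
    proof -
      have "z \<in> R ` {..<m}"
        using R that by (simp add: bij_betw_def)
      thus ?thesis using that
        by (auto simp: poly_prod poly_monom)
    qed
  qed (simp_all add: deg degree_prod_linear)
  finally show ?thesis .
qed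

lemma cyclotomic_complex_monic: "lead_coeff (cyclotomic_complex m) = 1"
  unfolding cyclotomic_complex_def by (rule lead_coeff_prod_monic) simp

text \<open>By induction X^m - 1 is divided by the product \<open>Q\<close> of the earlier
  cyclotomic polynomials, which is monic and integral. Division over the integers then agrees with
  division over the complex numbers, where the remainder is 0.\<close>

lemma cyclotomic_complex_integral:
  assumes "m > 0"
  shows "\<exists>P :: int poly. lead_coeff P = 1 \<and> map_poly of_int P = cyclotomic_complex m"
  using assms
proof (induction m rule: less_induct)
  case (less m)
  have "\<exists>P. \<forall>d. d dvd m \<and> d < m \<longrightarrow> lead_coeff (P d) = 1 \<and>
          map_poly of_int (P d :: int poly) = cyclotomic_complex d"
    using less by (intro choice) (metis dvd_pos_nat)
  then obtain P where P: "\<And>d. d dvd m \<Longrightarrow> d < m \<Longrightarrow> lead_coeff (P d) = 1"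
    "\<And>d. d dvd m \<Longrightarrow> d < m \<Longrightarrow> map_poly of_int (P d :: int poly) = cyclotomic_complex d"
    by blast
  define D where "D = {d. d dvd m \<and> d < m}"
  define Q where "Q = (\<Prod>d\<in>D. P d)"
  have Q1: "lead_coeff Q = 1"
    unfolding Q_def by (rule lead_coeff_prod_monic) (auto simp: D_def P)
  have "{d. d dvd m} = insert m D"
    using less.prems by (auto simp: D_def dest: dvd_imp_le)
  hence "monom 1 m - 1 = cyclotomic_complex m * (\<Prod>d\<in>D. cyclotomic_complex d)"
    using prod_cyclotomic_complex[OF less.prems] by (simp add: D_def)
  also have "(\<Prod>d\<in>D. cyclotomic_complex d) = map_poly of_int Q"
    unfolding Q_def of_int_hom.map_poly_hom_prod by (intro prod.cong) (auto simp: D_def P)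
  finally have eq: "monom 1 m - 1 = cyclotomic_complex m * map_poly of_int Q" .
  \<comment> \<open>As \<open>Q\<close> is monic, pseudo-division introduces no power of the leading
    coefficient and is ordinary division.\<close>
  obtain t r where tr: "pseudo_divmod (monom 1 m - 1) Q = (t, r)"
    by (cases "pseudo_divmod (monom 1 m - 1) Q")
  have Q0: "Q \<noteq> 0" using Q1 by auto
  have "monom 1 m - 1 = Q * t + r" and r: "r = 0 \<or> degree r < degree Q"
    using pseudo_divmod[OF Q0 tr] Q1 by simp_all
  hence "map_poly of_int (monom 1 m - 1 :: int poly) = map_poly of_int Q * map_poly of_int t + (map_poly of_int r :: complex poly)"
    by (simp add: of_int_hom.map_poly_hom_add of_int_hom.map_poly_hom_mult)
  moreover have "map_poly of_int (monom 1 m - 1 :: int poly) = (monom 1 m - 1 :: complex poly)"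
    by (intro poly_eqI) simp
  ultimately have *: "map_poly of_int Q * (cyclotomic_complex m - map_poly of_int t) = (map_poly of_int r :: complex poly)"
    using eq by (simp add: algebra_simps)
  have degQ: "degree (map_poly of_int Q :: complex poly) = degree Q" "map_poly of_int Q \<noteq> (0 :: complex poly)"
    using of_int_hom.map_poly_hom_monic[OF Q1, where ?'a = complex] by fastforce+
  have "cyclotomic_complex m = map_poly of_int t"
  proof (rule ccontr)
    assume ne: "cyclotomic_complex m \<noteq> map_poly of_int t"
    hence "map_poly of_int r \<noteq> (0 :: complex poly)"
      using * degQ by auto
    hence "degree r < degree Q" using r by auto
    moreover have "degree Q \<le> degree (map_poly of_int r :: complex poly)"
      unfolding *[symmetric] using ne degQ by (subst degree_mult_eq) auto
    moreover have "degree (map_poly of_int r :: complex poly) \<le> degree r"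
      by (rule map_poly_degree_leq)
    ultimately show False by linarith
  qed
  moreover from this have "lead_coeff t = 1"
    using cyclotomic_complex_monic[of m] degree_map_poly[of "of_int :: int \<Rightarrow> complex" t] by simp
  ultimately show ?case by metis
qed

text \<open>The complex coefficients are integers, so rounding their real parts loses
  nothing.\<close>

lemma of_int_cyclotomic_int:
  assumes "m > 0"
  shows "map_poly of_int (cyclotomic_int m) = cyclotomic_complex m" "lead_coeff (cyclotomic_int m) = 1"
proof -
  obtain P :: "int poly" where P: "lead_coeff P = 1" "map_poly of_int P = cyclotomic_complex m"
    using cyclotomic_complex_integral[OF assms] by blast
  have "cyclotomic_int m = P"
    unfolding cyclotomic_int_def P(2)[symmetric]
    by (intro poly_eqI) (simp add: coeff_map_poly)
  thus "map_poly of_int (cyclotomic_int m) = cyclotomic_complex m" "lead_coeff (cyclotomic_int m) = 1"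
    using P by simp_all
qed

lemma prod_cyclotomic:
  assumes "m > 0"
  shows "(\<Prod>d | d dvd m. cyclotomic d) = (monom 1 m - 1 :: 'a :: comm_ring_1 poly)"
proof -
  have "map_poly of_int (\<Prod>d | d dvd m. cyclotomic_int d) = (\<Prod>d | d dvd m. cyclotomic_complex d)"
    unfolding of_int_hom.map_poly_hom_prod
    using assms by (intro prod.cong) (auto intro!: of_int_cyclotomic_int dest: dvd_pos_nat)
  also have "\<dots> = map_poly of_int (monom 1 m - 1 :: int poly)"
    unfolding prod_cyclotomic_complex[OF assms] by (intro poly_eqI) simp
  finally have "(\<Prod>d | d dvd m. cyclotomic_int d) = monom 1 m - 1"
    unfolding poly_eq_iff of_int_hom.coeff_map_hom of_int_eq_iff .
  hence "map_poly of_int (\<Prod>d | d dvd m. cyclotomic_int d) = map_poly of_int (monom 1 m - 1 :: int poly)"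
    by simp
  also have "\<dots> = (monom 1 m - 1 :: 'a poly)"
    by (intro poly_eqI) simp
  finally show ?thesis
    unfolding of_int_hom.map_poly_hom_prod cyclotomic_def .
qed

lemma cyclotomic_monic:
  assumes "m > 0"
  shows "lead_coeff (cyclotomic m :: 'a :: comm_ring_1 poly) = 1"
  unfolding cyclotomic_def by (intro of_int_hom.map_poly_hom_monic of_int_cyclotomic_int assms)

text \<open>Since X^m - 1 is the product of the Phi_d, \<open>x\<close> is a root of some Phi_d with
  d dividing m; then x^d = 1, and the exact order of \<open>x\<close> forces d = m. This works in
  any characteristic.\<close>

lemma cyclotomic_root:
  fixes x :: "'a :: idom"
  assumes "m > 0" and "x ^ m = 1" and "\<And>d. d dvd m \<Longrightarrow> x ^ d = 1 \<Longrightarrow> d = m"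
  shows "poly (cyclotomic m) x = 0"
proof -
  have fin: "finite {d. d dvd n}" if "n > 0" for n :: nat
    using that by simp
  have "(\<Prod>d | d dvd m. poly (cyclotomic d) x) = x ^ m - 1"
    using arg_cong[OF prod_cyclotomic[OF assms(1)], of "\<lambda>p. poly p x"] by (simp add: poly_prod poly_monom)
  then obtain d where d: "d dvd m" "poly (cyclotomic d) x = 0"
    using fin[OF assms(1)] assms(2) by (auto simp: prod_zero_iff)
  have "d > 0" using d assms(1) by (auto dest: dvd_pos_nat)
  have "(\<Prod>c | c dvd d. poly (cyclotomic c) x) = x ^ d - 1"
    using arg_cong[OF prod_cyclotomic[OF \<open>d > 0\<close>], of "\<lambda>p. poly p x"] by (simp add: poly_prod poly_monom)
  moreover have "(\<Prod>c | c dvd d. poly (cyclotomic c) x) = 0"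
    using d(2) by (intro prod_zero fin[OF \<open>d > 0\<close>] bexI[of _ d]) simp_all
  ultimately show ?thesis using assms(3)[OF d(1)] d by simp
qed

section \<open>Monic polynomials over a finite subfield of an algebraically closed field\<close>

lemma alg_closed_proots:
  fixes p :: "'k :: alg_closed_field poly"
  assumes "p \<noteq> 0"
  shows "size (proots p) = degree p" "p = smult (lead_coeff p) (\<Prod>x\<in>#proots p. [:-x, 1:])"
proof -
  obtain A where A: "size A = degree p" "p = smult (lead_coeff p) (\<Prod>x\<in>#A. [:-x, 1:])"
    using alg_closed_imp_factorization[OF assms] by blast
  have "proots p = proots (\<Prod>x\<in>#A. [:-x, 1:])"
    using assms by (subst A(2)) simp
  also have "\<dots> = A"
    by (induction A) (simp_all add: proots_mult prod_mset_zero_iff image_iff del: mult_pCons_left)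
  finally show "size (proots p) = degree p" "p = smult (lead_coeff p) (\<Prod>x\<in>#proots p. [:-x, 1:])"
    using A by simp_all
qed

lemma sum_order_eq_degree:
  fixes p :: "'k :: alg_closed_field poly"
  assumes "p \<noteq> 0"
  shows "(\<Sum>x | poly p x = 0. Polynomial.order x p) = degree p"
  using alg_closed_proots(1)[OF assms] assms by (simp add: size_multiset_overloaded_eq)

lemma monic_eq_prod_linear_powers:
  fixes p :: "'k :: alg_closed_field poly"
  assumes "lead_coeff p = 1" and "finite R" and "\<And>x. poly p x = 0 \<Longrightarrow> x \<in> R"
  shows "p = (\<Prod>x\<in>R. [:-x, 1:] ^ Polynomial.order x p)"
proof -
  have nz: "p \<noteq> 0" using assms by auto
  have "p = (\<Prod>x\<in>#proots p. [:-x, 1:])"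
    using alg_closed_proots(2)[OF nz] assms(1) by simp
  also have "\<dots> = (\<Prod>x | poly p x = 0. [:-x, 1:] ^ Polynomial.order x p)"
    using nz by (simp add: image_prod_mset_multiplicity)
  also have "\<dots> = (\<Prod>x\<in>R. [:-x, 1:] ^ Polynomial.order x p)"
    using assms nz by (intro prod.mono_neutral_left) (auto simp: order_root)
  finally show ?thesis .
qed

lemma prod_linear_power_dvd:
  fixes f :: "'k :: field poly"
  assumes "f \<noteq> 0" and "finite I" and "inj_on c I" and "\<And>i. i \<in> I \<Longrightarrow> j \<le> Polynomial.order (c i) f"
  shows "(\<Prod>i\<in>I. [:- c i, 1:]) ^ j dvd f"
  using assms(2-)
proof (induction I rule: finite_induct)
  case (insert x I)
  define P where "P = (\<Prod>i\<in>I. [:- c i, 1:]) ^ j"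
  have "P dvd f" unfolding P_def using insert by (intro insert.IH) auto
  then obtain g where g: "f = P * g" by (elim dvdE)
  have "poly P (c x) \<noteq> 0"
    using insert by (auto simp: P_def poly_prod inj_on_def)
  hence "Polynomial.order (c x) f = Polynomial.order (c x) g"
    using assms(1) unfolding g by (subst order_mult) (simp_all add: order_0I)
  hence "[:- c x, 1:] ^ j dvd g"
    using insert.prems(2)[of x] by (auto simp: order_divides)
  hence "[:- c x, 1:] ^ j * P dvd f"
    unfolding g by (simp add: mult.commute mult_dvd_mono)
  thus ?case using insert.hyps by (simp add: P_def power_mult_distrib del: mult_pCons_left)
qed simp

lemma prod_lessThan_add:
  fixes f :: "nat \<Rightarrow> 'b :: comm_monoid_mult"
  shows "prod f {..<a + b} = prod f {..<a} * (\<Prod>i<b. f (a + i))"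
  by (induction b) (simp_all add: mult_ac)

text \<open>The base field GF(\<open>q\<close>) enters through its Frobenius map.
  \<open>of_nat_q\<close> makes X^(q^N) - X separable, and \<open>Z\<close> will hold the roots of
  the polynomials that define the characters, all rational over GF(\<open>q\<close>).\<close>

locale frobenius =
  fixes q :: nat and Z :: "'k :: alg_closed_field set"
  assumes q_gt_1: "q > 1"
    and of_nat_q: "of_nat q = (0 :: 'k)"
    and frob_add: "(x + y) ^ q = x ^ q + (y :: 'k) ^ q"
    and finite_Z: "finite Z"
    and frob_Z: "\<alpha> \<in> Z \<Longrightarrow> \<alpha> ^ q = \<alpha>"
begin

text \<open>For N > 0 this is the field with q^N elements; the degenerate \<open>subfld 0\<close> is
  the whole of the big field.\<close>

definition subfld :: "nat \<Rightarrow> 'k set" where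
  "subfld N = {x. x ^ (q ^ N) = x}"

text \<open>Frobenius invariance says that the coefficients lie in GF(\<open>q\<close>), while the
  polynomials stay over the algebraically closed field where their roots live.\<close>

definition monics :: "nat \<Rightarrow> 'k poly set" where
  "monics d = {f. degree f = d \<and> lead_coeff f = 1 \<and> map_poly (\<lambda>x. x ^ q) f = f}"

text \<open>For \<open>\<theta>\<close> in the extension of degree \<open>N\<close> this is the characteristic polynomial of \<open>\<theta>\<close>,
  a power of its minimal polynomial.\<close>
definition charpoly :: "nat \<Rightarrow> 'k \<Rightarrow> 'k poly" where
  "charpoly N \<theta> = (\<Prod>i<N. [:- (\<theta> ^ (q ^ i)), 1:])"

section \<open>The Frobenius map and its fixed fields\<close>

lemma frob_power_hom: "coeff_hom (\<lambda>x :: 'k. x ^ (q ^ N))"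
proof
  show "(x + y) ^ q ^ N = x ^ q ^ N + y ^ q ^ N" for x y :: 'k
    by (induction N) (simp_all add: power_mult frob_add mult.commute[of q])
qed (simp_all add: power_mult_distrib)

sublocale frob: coeff_hom "\<lambda>x :: 'k. x ^ q"
  using frob_power_hom[of 1] by simp

lemma frob_power_inj: "x = y" if "x ^ (q ^ N) = (y :: 'k) ^ (q ^ N)"
proof -
  have "(x - y) ^ (q ^ N) = 0"
    using that coeff_hom.hom_diff[OF frob_power_hom, of x y N] by simp
  thus ?thesis by simp
qed

lemma frob_power_add: "x ^ (q ^ (i + j)) = (x ^ (q ^ i)) ^ (q ^ j)" for x :: 'k
  by (simp add: power_add power_mult)

text \<open>The derivative of X^(q^N) - X is -1, so its roots are simple and their number is the
  degree.\<close>

lemma card_subfld: 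
  assumes "N > 0"
  shows "finite (subfld N)" "card (subfld N) = q ^ N"
proof -
  define p :: "'k poly" where "p = monom 1 (q ^ N) - monom 1 1"
  have "q ^ N > 1" using q_gt_1 assms by (intro one_less_power)
  hence deg: "degree p = q ^ N"
    unfolding p_def diff_conv_add_uminus by (subst degree_add_eq_left) (simp_all add: degree_monom_eq)
  hence p0: "p \<noteq> 0" using q_gt_1 by auto
  have roots: "subfld N = {x. poly p x = 0}"
    by (auto simp: subfld_def p_def poly_monom)
  thus "finite (subfld N)" using p0 by (simp add: poly_roots_finite)
  have pd: "pderiv p = -1"
    using assms of_nat_q by (simp add: p_def pderiv_diff pderiv_monom)
  have "Polynomial.order x p = 1" if x: "poly p x = 0" for x
  proof -
    have "\<not> 2 \<le> Polynomial.order x p"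
    proof
      assume "2 \<le> Polynomial.order x p"
      then obtain r where "p = [:-x, 1:] ^ 2 * r"
        using order_divides[of x 2 p] by (auto elim: dvdE)
      hence "p = [:-x, 1:] * ([:-x, 1:] * r)" by (simp only: power2_eq_square mult.assoc)
      hence "poly (pderiv p) x = 0"
        by (simp add: pderiv_mult pderiv_pCons del: mult_pCons_left)
      thus False by (simp add: pd)
    qed
    moreover have "Polynomial.order x p > 0" using x p0 by (simp add: order_gt_0_iff)
    ultimately show ?thesis by linarith
  qed
  hence "(\<Sum>x | poly p x = 0. Polynomial.order x p) = card {x. poly p x = 0}"
    by simp
  thus "card (subfld N) = q ^ N"
    using sum_order_eq_degree[OF p0] by (simp add: roots deg)
qed

lemma finite_monics: "finite (monics d)"
proof (rule finite_subset)
  show "monics d \<subseteq> Poly ` {xs. set xs \<subseteq> subfld 1 \<and> length xs = Suc d}"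
  proof
    fix f assume f: "f \<in> monics d"
    have "coeff f i \<in> subfld 1" for i
    proof -
      have "coeff (map_poly (\<lambda>x. x ^ q) f) i = coeff f i" using f by (simp add: monics_def)
      thus ?thesis by (simp add: subfld_def)
    qed
    hence "set (coeffs f) \<subseteq> subfld 1"
      by (auto simp: coeffs_def)
    moreover have "length (coeffs f) = Suc d"
      using f by (subst length_coeffs_degree) (auto simp: monics_def)
    ultimately show "f \<in> Poly ` {xs. set xs \<subseteq> subfld 1 \<and> length xs = Suc d}"
      by (intro image_eqI[of _ _ "coeffs f"]) auto
  qed
  show "finite (Poly ` {xs. set xs \<subseteq> subfld 1 \<and> length xs = Suc d})"
    using card_subfld[of 1] by (intro finite_imageI finite_lists_length_eq) simp
qed

section \<open>Monic polynomials over GF(\<open>q\<close>) and Frobenius orbits of their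
  roots\<close>

lemma monics_mult: "f \<in> monics d \<Longrightarrow> g \<in> monics e \<Longrightarrow> f * g \<in> monics (d + e)"
  unfolding monics_def by (auto simp: lead_coeff_mult frob.map_poly_hom_mult intro!: degree_mult_eq)

lemma monics_quotient:
  assumes "f \<in> monics d" "p \<in> monics e" "f = p * g"
  shows "g \<in> monics (d - e)" "e \<le> d"
proof -
  have nz: "f \<noteq> 0" using assms by (auto simp: monics_def)
  hence nz': "p \<noteq> 0" "g \<noteq> 0" using assms(3) by auto
  hence "degree f = degree p + degree g" using assms(3) by (simp add: degree_mult_eq)
  moreover have "lead_coeff g = 1"
    using assms by (auto simp: monics_def lead_coeff_mult)
  moreover have "p * map_poly (\<lambda>x. x ^ q) g = p * g"
    using assms frob.map_poly_hom_mult[of p g] by (simp add: monics_def)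
  ultimately show "g \<in> monics (d - e)" "e \<le> d"
    using assms nz' by (auto simp: monics_def)
qed

lemma charpoly_in_monics:
  assumes "\<theta> \<in> subfld N"
  shows "charpoly N \<theta> \<in> monics N"
proof -
  have "map_poly (\<lambda>x. x ^ q) (charpoly N \<theta>) = (\<Prod>i<N. [:- (\<theta> ^ (q ^ Suc i)), 1:])"
    unfolding charpoly_def frob.map_poly_hom_prod
    by (intro prod.cong refl) (simp add: frob.map_poly_hom_pCons frob.hom_uminus flip: power_mult, simp add: mult.commute)
  \<comment> \<open>Frobenius has shifted the conjugates by one; \<theta>^(q^N) = \<theta> closes
    the cycle.\<close>
  also have "\<dots> = charpoly N \<theta>"
  proof (cases N)
    case (Suc M)
    have "[:- (\<theta> ^ (q ^ Suc M)), 1:] = [:- (\<theta> ^ (q ^ 0)), 1:]"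
      using assms unfolding subfld_def Suc by simp
    thus ?thesis
      unfolding charpoly_def Suc
      by (subst prod.lessThan_Suc, subst prod.lessThan_Suc_shift) (simp only: mult.commute)
  qed (simp add: charpoly_def)
  finally show ?thesis
    using lead_coeff_prod_monic[of "{..<N}" "\<lambda>i. [:- (\<theta> ^ (q ^ i)), 1:]"]
    by (simp add: monics_def charpoly_def degree_prod_linear)
qed

text \<open>Applying Frobenius to the coefficients fixes \<open>f\<close> and carries a factor (X -
  x)^k to (X - x^q)^k, so multiplicities cannot drop along an orbit.\<close>

lemma order_frob_power:
  assumes "f \<in> monics d"
  shows "Polynomial.order \<theta> f \<le> Polynomial.order (\<theta> ^ (q ^ i)) f"
proof (induction i)
  case (Suc i)
  have nz: "f \<noteq> 0" using assms by (auto simp: monics_def)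
  define x where "x = \<theta> ^ (q ^ i)"
  define k where "k = Polynomial.order x f"
  obtain g where "f = [:- x, 1:] ^ k * g"
    using order_1[of x f] by (auto simp: k_def elim: dvdE)
  hence "map_poly (\<lambda>x. x ^ q) f = map_poly (\<lambda>x. x ^ q) ([:- x, 1:] ^ k * g)" by simp
  hence "f = [:- (x ^ q), 1:] ^ k * map_poly (\<lambda>x. x ^ q) g"
    using assms by (simp add: monics_def frob.map_poly_hom_mult frob.map_poly_hom_power
        frob.map_poly_hom_pCons frob.hom_uminus)
  hence "[:- (x ^ q), 1:] ^ k dvd f" by (rule dvdI)
  hence "k \<le> Polynomial.order (x ^ q) f" using nz by (simp add: order_divides)
  moreover have "x ^ q = \<theta> ^ (q ^ Suc i)" by (simp add: x_def mult.commute flip: power_mult)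
  ultimately show ?case using Suc by (simp add: k_def x_def)
qed simp

lemma frob_power_period: "\<theta> ^ (q ^ (e * k)) = \<theta>" if "\<theta> \<in> subfld e"
  using that by (induction k) (simp_all add: subfld_def frob_power_add)

text \<open>The sequence of conjugates has period \<open>e\<close>, so the longer product runs
  through it \<open>j\<close> times.\<close>

lemma charpoly_mult_degree: "charpoly (e * j) \<theta> = charpoly e \<theta> ^ j" if "\<theta> \<in> subfld e"
proof (induction j)
  case (Suc j)
  have "charpoly (e * Suc j) \<theta> = charpoly (e * j + e) \<theta>" by (simp add: add.commute)
  also have "\<dots> = charpoly (e * j) \<theta> * charpoly e \<theta>"
    unfolding charpoly_def prod_lessThan_add frob_power_add frob_power_period[OF that] ..
  finally show ?case using Suc by simp
qed (simp add: charpoly_def)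

text \<open>The Frobenius orbit stays among the finitely many roots of \<open>f\<close>, so two
  iterates coincide; injectivity of Frobenius moves the coincidence back to \<theta>.\<close>

lemma root_in_subfld:
  assumes f: "f \<in> monics d" and root: "poly f \<theta> = 0"
  shows "\<exists>e. e > 0 \<and> \<theta> \<in> subfld e"
proof -
  have nz: "f \<noteq> 0" using f by (auto simp: monics_def)
  have "Polynomial.order (\<theta> ^ (q ^ i)) f \<noteq> 0" for i
    using order_frob_power[OF f, of \<theta> i] root nz order_root[of f \<theta>] by linarith
  hence "range (\<lambda>i. \<theta> ^ (q ^ i)) \<subseteq> {x. poly f x = 0}"
    using nz by (auto simp: order_root)
  hence "finite (range (\<lambda>i. \<theta> ^ (q ^ i)))"
    using poly_roots_finite[OF nz] by (rule finite_subset)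
  hence "\<not> inj (\<lambda>i. \<theta> ^ (q ^ i))"
    using finite_imageD infinite_UNIV_nat by blast
  then obtain i j where "\<theta> ^ (q ^ i) = \<theta> ^ (q ^ j)" "i < j"
    unfolding inj_def by (metis linorder_neqE_nat)
  hence "(\<theta> ^ (q ^ (j - i))) ^ (q ^ i) = \<theta> ^ (q ^ i)"
    by (simp flip: frob_power_add)
  hence "\<theta> ^ (q ^ (j - i)) = \<theta>" by (rule frob_power_inj)
  thus ?thesis
    using \<open>i < j\<close> by (intro exI[of _ "j - i"]) (simp add: subfld_def)
qed

text \<open>If \<open>e\<close> is the exact degree of \<theta>, then
  \<open>charpoly e \<theta>\<close> is its minimal polynomial, and the admissible \<open>N\<close>
  are the positive multiples \<open>e * j\<close> for which the \<open>j\<close>-th power of this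
  polynomial divides \<open>f\<close>.\<close>

lemma card_charpoly_degrees:
  assumes f: "f \<in> monics d" and root: "poly f \<theta> = 0"
  shows "card {N \<in> {1..d}. \<theta> \<in> subfld N \<and> charpoly N \<theta> dvd f} = Polynomial.order \<theta> f"
proof -
  have nz: "f \<noteq> 0" using f by (auto simp: monics_def)
  note ex = root_in_subfld[OF f root]
  define e where "e = (LEAST e. e > 0 \<and> \<theta> \<in> subfld e)"
  have e: "e > 0" "\<theta> \<in> subfld e"
    using LeastI_ex[OF ex] unfolding e_def by auto
  have e_le: "e \<le> k" if "k > 0" "\<theta> \<in> subfld k" for k
    unfolding e_def using that by (intro Least_le) auto
  note per = frob_power_period[OF e(2)]
  have sub_iff: "\<theta> \<in> subfld N \<longleftrightarrow> e dvd N" for N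
  proof
    assume N: "\<theta> \<in> subfld N"
    have "\<theta> ^ (q ^ N) = \<theta> ^ (q ^ (N mod e))"
      using frob_power_add[of \<theta> "e * (N div e)" "N mod e"] by (simp add: per)
    hence "\<theta> \<in> subfld (N mod e)" using N by (simp add: subfld_def)
    hence "N mod e = 0" using e_le[of "N mod e"] e(1) by (meson linorder_not_le mod_less_divisor neq0_conv)
    thus "e dvd N" by auto
  next
    assume "e dvd N"
    thus "\<theta> \<in> subfld N" using per by (auto simp: subfld_def elim: dvdE)
  qed
  have inj: "inj_on (\<lambda>i. \<theta> ^ (q ^ i)) {..<e}"
  proof (rule linorder_inj_onI')
    fix i j assume ij: "i \<in> {..<e}" "j \<in> {..<e}" "i < j"
    show "\<theta> ^ (q ^ i) \<noteq> \<theta> ^ (q ^ j)"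
    proof
      assume "\<theta> ^ (q ^ i) = \<theta> ^ (q ^ j)"
      hence "(\<theta> ^ (q ^ (j - i))) ^ (q ^ i) = \<theta> ^ (q ^ i)"
        using ij by (simp flip: frob_power_add)
      hence "\<theta> ^ (q ^ (j - i)) = \<theta>" by (rule frob_power_inj)
      hence "e \<le> j - i" using ij by (intro e_le) (auto simp: subfld_def)
      thus False using ij by auto
    qed
  qed
  note pow = charpoly_mult_degree[OF e(2)]
  \<comment> \<open>The conjugates are distinct, and each has in \<open>f\<close> at least the
    multiplicity of \<theta>, so divisibility is decided at \<theta> alone.\<close>
  have dvd_iff: "charpoly e \<theta> ^ j dvd f \<longleftrightarrow> j \<le> Polynomial.order \<theta> f" for j
  proof
    assume *: "charpoly e \<theta> ^ j dvd f"
    have "[:- \<theta>, 1:] dvd charpoly e \<theta>"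
      unfolding charpoly_def using e(1) dvd_prodI[of "{..<e}" 0 "\<lambda>i. [:- (\<theta> ^ (q ^ i)), 1:]"] by simp
    hence "[:- \<theta>, 1:] ^ j dvd f" using * dvd_power_same dvd_trans by blast
    thus "j \<le> Polynomial.order \<theta> f" using nz by (simp add: order_divides)
  next
    assume "j \<le> Polynomial.order \<theta> f"
    thus "charpoly e \<theta> ^ j dvd f"
      unfolding charpoly_def using order_frob_power[OF f, of \<theta>]
      by (intro prod_linear_power_dvd nz inj) (auto intro: order_trans)
  qed
  have "{N \<in> {1..d}. \<theta> \<in> subfld N \<and> charpoly N \<theta> dvd f} = (\<lambda>j. e * j) ` {1..Polynomial.order \<theta> f}"
  proof (intro equalityI subsetI)
    fix N assume N: "N \<in> {N \<in> {1..d}. \<theta> \<in> subfld N \<and> charpoly N \<theta> dvd f}"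
    then obtain j where j: "N = e * j" using sub_iff by (auto elim: dvdE)
    with N have "j \<ge> 1" "j \<le> Polynomial.order \<theta> f"
      by (auto simp: pow dvd_iff Suc_le_eq)
    thus "N \<in> (\<lambda>j. e * j) ` {1..Polynomial.order \<theta> f}"
      using j by auto
  next
    fix N assume "N \<in> (\<lambda>j. e * j) ` {1..Polynomial.order \<theta> f}"
    then obtain j where j: "N = e * j" "j \<ge> 1" "j \<le> Polynomial.order \<theta> f"
      by (metis atLeastAtMost_iff imageE)
    hence N: "\<theta> \<in> subfld N" "charpoly N \<theta> dvd f"
      by (auto simp: sub_iff pow dvd_iff)
    have "N \<le> d" 
      using monics_quotient(2)[OF f charpoly_in_monics[OF N(1)]] N(2) by (auto elim: dvdE)
    thus "N \<in> {N \<in> {1..d}. \<theta> \<in> subfld N \<and> charpoly N \<theta> dvd f}"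
      using N j e by (auto simp: Suc_le_eq)
  qed
  thus ?thesis using e(1) by (simp add: card_image inj_on_def)
qed

text \<open>Counting pairs (N, \<theta>) by \<theta> first gives the sum of the root multiplicities.
  This is the polynomial analogue of writing log n as the sum of the von Mangoldt function over the
  divisors of n.\<close>

lemma card_charpoly_divisors:
  assumes f: "f \<in> monics d"
  shows "(\<Sum>N=1..d. card {\<theta> \<in> subfld N. charpoly N \<theta> dvd f}) = d"
proof -
  have nz: "f \<noteq> 0" using f by (auto simp: monics_def)
  have fin: "finite {x. poly f x = 0}" using nz by (simp add: poly_roots_finite)
  have root: "poly f \<theta> = 0" if "N \<ge> 1" "charpoly N \<theta> dvd f" for N \<theta>
  proof -
    have "[:- \<theta>, 1:] dvd charpoly N \<theta>"
      unfolding charpoly_def using that(1) dvd_prodI[of "{..<N}" 0 "\<lambda>i. [:- (\<theta> ^ (q ^ i)), 1:]"] by simp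
    thus ?thesis using that(2) by (meson dvd_trans poly_eq_0_iff_dvd)
  qed
  have "(\<Sum>N=1..d. card {\<theta> \<in> subfld N. charpoly N \<theta> dvd f}) =
        (\<Sum>N\<in>{1..d}. \<Sum>\<theta>\<in>{\<theta>. poly f \<theta> = 0}. if \<theta> \<in> subfld N \<and> charpoly N \<theta> dvd f then 1 else 0)"
  proof (intro sum.cong refl)
    fix N assume "N \<in> {1..d}"
    hence "{\<theta> \<in> subfld N. charpoly N \<theta> dvd f} =
           {\<theta>. poly f \<theta> = 0} \<inter> {\<theta>. \<theta> \<in> subfld N \<and> charpoly N \<theta> dvd f}"
      using root[of N] by auto
    thus "card {\<theta> \<in> subfld N. charpoly N \<theta> dvd f} =
      (\<Sum>\<theta>\<in>{\<theta>. poly f \<theta> = 0}. if \<theta> \<in> subfld N \<and> charpoly N \<theta> dvd f then 1 else 0)"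
      using fin by (simp add: sum.If_cases)
  qed
  also have "\<dots> = (\<Sum>\<theta>\<in>{\<theta>. poly f \<theta> = 0}. \<Sum>N\<in>{1..d}. if \<theta> \<in> subfld N \<and> charpoly N \<theta> dvd f then 1 else 0)"
    by (rule sum.swap)
  also have "\<dots> = (\<Sum>\<theta>\<in>{\<theta>. poly f \<theta> = 0}. Polynomial.order \<theta> f)"
    using card_charpoly_degrees[OF f]
    by (intro sum.cong refl) (auto simp: sum.If_cases Int_def)
  also have "\<dots> = d"
    using sum_order_eq_degree[OF nz] f by (simp add: monics_def)
  finally show ?thesis .
qed

text \<open>This is the logarithmic derivative of the Euler product of \<open>\<chi>\<close>, read off coefficientwise.\<close>
lemma newton_recurrence:
  fixes \<chi> :: "'k poly \<Rightarrow> complex"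
  assumes mult: "\<And>f g d e. f \<in> monics d \<Longrightarrow> g \<in> monics e \<Longrightarrow> \<chi> (f * g) = \<chi> f * \<chi> g"
  shows "of_nat d * (\<Sum>f\<in>monics d. \<chi> f) =
         (\<Sum>N=1..d. (\<Sum>\<theta>\<in>subfld N. \<chi> (charpoly N \<theta>)) * (\<Sum>g\<in>monics (d - N). \<chi> g))"
proof -
  \<comment> \<open>The products of \<open>charpoly N \<theta>\<close> with the monic
    \<open>g\<close> of complementary degree are exactly its multiples in
    \<open>monics d\<close>.\<close>
  have inner: "\<chi> (charpoly N \<theta>) * (\<Sum>g\<in>monics (d - N). \<chi> g) =
      (\<Sum>f\<in>monics d. if charpoly N \<theta> dvd f then \<chi> f else 0)" if N: "N \<in> {1..d}" "\<theta> \<in> subfld N" for N \<theta>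
  proof -
    define P where "P = charpoly N \<theta>"
    have P: "P \<in> monics N" unfolding P_def using N by (intro charpoly_in_monics)
    have nz: "P \<noteq> 0" using P by (auto simp: monics_def)
    have "\<chi> P * (\<Sum>g\<in>monics (d - N). \<chi> g) = (\<Sum>g\<in>monics (d - N). \<chi> (P * g))"
      unfolding sum_distrib_left using P by (intro sum.cong refl) (simp add: mult)
    also have "\<dots> = (\<Sum>f\<in>{f \<in> monics d. P dvd f}. \<chi> f)"
    proof (rule sum.reindex_bij_witness[of _ "\<lambda>f. f div P" "\<lambda>g. P * g"])
      fix g assume "g \<in> monics (d - N)"
      thus "P * g \<in> {f \<in> monics d. P dvd f}" using monics_mult[OF P, of g "d - N"] N by simp
    next
      fix f assume "f \<in> {f \<in> monics d. P dvd f}"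
      thus "f div P \<in> monics (d - N)" using monics_quotient(1)[OF _ P, of f d "f div P"] by simp
    qed (use nz in auto)
    also have "\<dots> = (\<Sum>f\<in>monics d. if P dvd f then \<chi> f else 0)"
      using finite_monics by (simp add: sum.inter_filter)
    finally show ?thesis unfolding P_def .
  qed
  have "(\<Sum>N=1..d. (\<Sum>\<theta>\<in>subfld N. \<chi> (charpoly N \<theta>)) * (\<Sum>g\<in>monics (d - N). \<chi> g)) =
        (\<Sum>N=1..d. \<Sum>\<theta>\<in>subfld N. \<Sum>f\<in>monics d. if charpoly N \<theta> dvd f then \<chi> f else 0)"
    unfolding sum_distrib_right by (intro sum.cong refl inner)
  also have "\<dots> = (\<Sum>N=1..d. \<Sum>f\<in>monics d. \<Sum>\<theta>\<in>subfld N. if charpoly N \<theta> dvd f then \<chi> f else 0)"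
    by (intro sum.cong refl sum.swap)
  also have "\<dots> = (\<Sum>f\<in>monics d. \<Sum>N=1..d. \<Sum>\<theta>\<in>subfld N. if charpoly N \<theta> dvd f then \<chi> f else 0)"
    by (rule sum.swap)
  also have "\<dots> = (\<Sum>f\<in>monics d. \<Sum>N=1..d. of_nat (card {\<theta> \<in> subfld N. charpoly N \<theta> dvd f}) * \<chi> f)"
    using card_subfld by (intro sum.cong refl) (simp add: sum.If_cases Int_def)
  also have "\<dots> = (\<Sum>f\<in>monics d. of_nat d * \<chi> f)"
  proof (intro sum.cong refl)
    fix f assume f: "f \<in> monics d"
    show "(\<Sum>N=1..d. of_nat (card {\<theta> \<in> subfld N. charpoly N \<theta> dvd f}) * \<chi> f) = of_nat d * \<chi> f"
      unfolding sum_distrib_right[symmetric] of_nat_sum[symmetric] card_charpoly_divisors[OF f] ..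
  qed
  finally show ?thesis by (simp add: sum_distrib_left)
qed

end

section \<open>Character sums\<close>

lemma sum_powers_root_of_unity:
  fixes z :: "'a :: field"
  assumes "z ^ n = 1"
  shows "(\<Sum>t=1..n. z ^ t) = (if z = 1 then of_nat n else 0)"
proof (cases "z = 1")
  case False
  have "(\<Sum>t=1..n. z ^ t) = z * (\<Sum>t<n. z ^ t)"
    unfolding sum_distrib_left
    by (rule sum.reindex_bij_witness[of _ Suc "\<lambda>t. t - 1"]) (auto simp flip: power_Suc)
  also have "(z - 1) * \<dots> = z * ((z - 1) * (\<Sum>t<n. z ^ t))" by (simp add: mult_ac)
  also have "\<dots> = 0" using assms by (simp flip: power_diff_1_eq)
  finally show ?thesis using False by simp
qed simp

text \<open>The equation is that of (1 - X)^s; its coefficient recurrence carries the factor n - s,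
  so all coefficients beyond \<open>s\<close> vanish.\<close>

lemma fps_poly_of_ode:
  fixes G :: "complex fps"
  assumes "(1 - fps_X) * fps_deriv G = - of_nat s * G"
  shows "\<exists>r. G = fps_of_poly r"
proof -
  have rec: "of_nat (Suc n) * G $ Suc n = (of_nat n - of_nat s) * G $ n" for n
  proof -
    have "((1 - fps_X) * fps_deriv G) $ n = of_nat (Suc n) * G $ Suc n - of_nat n * G $ n"
      by (cases n) (simp_all add: left_diff_distrib)
    moreover have "(- of_nat s * G) $ n = - of_nat s * G $ n"
      by (simp flip: fps_of_nat)
    ultimately have "of_nat (Suc n) * G $ Suc n - of_nat n * G $ n = - of_nat s * G $ n"
      by (simp only: assms)
    thus ?thesis by (simp only: left_diff_distrib eq_diff_eq diff_eq_eq) simp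
  qed
  have G0: "G $ n = 0" if "n > s" for n
    using that
  proof (induction n)
    case (Suc n)
    hence "(of_nat n - of_nat s) * G $ n = 0" by (cases "n = s") auto
    hence "of_nat (Suc n) * G $ Suc n = 0" by (simp only: rec)
    thus ?case by (simp del: of_nat_Suc)
  qed simp
  have "G = fps_of_poly (\<Sum>n\<le>s. monom (G $ n) n)"
    by (rule fps_ext) (auto simp: coeff_sum G0)
  thus ?thesis by blast
qed

text \<open>\<open>g\<close> generates the multiplicative group of GF(\<open>q\<close>), whose order
  q - 1 is divisible by \<open>m\<close>, so there is an m-th power residue symbol with complex
  values.\<close>

locale kummer_character = frobenius q Z
  for q :: nat and Z :: "'k :: alg_closed_field set" +
  fixes m :: nat and g :: 'k
  assumes m_pos: "m > 0" and m_dvd: "m dvd q - 1"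
    and generator: "\<And>z. z ^ q = z \<Longrightarrow> z \<noteq> 0 \<Longrightarrow> \<exists>i :: nat. z = g ^ i"
    and g_power_eq_1: "\<And>i :: nat. g ^ i = 1 \<longleftrightarrow> (q - 1) dvd i"
begin

definition \<zeta> :: complex where "\<zeta> = cis (2 * pi / real m)"

text \<open>On GF(\<open>q\<close>) this is the residue symbol, extended by 0. The chosen exponent
  is determined modulo q - 1, hence modulo \<open>m\<close>, so the choice does not matter.\<close>

definition \<omega> :: "'k \<Rightarrow> complex" where
  "\<omega> z = (if z = 0 then 0 else \<zeta> ^ (SOME i. z = g ^ i))"

text \<open>By reciprocity for polynomials this is, up to a sign, the symbol of the product of the
  (X - \<alpha>)^(k \<alpha>) modulo \<open>f\<close>; evaluating at the points of \<open>Z\<close>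
  makes it visibly multiplicative in \<open>f\<close>.\<close>

definition \<chi> :: "('k \<Rightarrow> nat) \<Rightarrow> 'k poly \<Rightarrow> complex" where
  "\<chi> k f = (\<Prod>\<alpha>\<in>Z. \<omega> (poly f \<alpha>) ^ k \<alpha>)"

text \<open>\<open>coeffL k\<close> is the coefficient sequence of the L-function of \<open>\<chi> k\<close>. The weights \<open>k \<alpha>\<close> have to
  be positive for \<open>\<chi> k\<close> to vanish at polynomials with a root in \<open>Z\<close>, since \<open>0 ^ 0 = 1\<close>.\<close>
definition coeffL :: "('k \<Rightarrow> nat) \<Rightarrow> nat \<Rightarrow> complex" where
  "coeffL k d = (\<Sum>f\<in>monics d. \<chi> k f)"

definition charsum :: "('k \<Rightarrow> nat) \<Rightarrow> nat \<Rightarrow> complex" where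
  "charsum k N = (\<Sum>\<theta>\<in>subfld N. \<chi> k (charpoly N \<theta>))"

section \<open>Multiplicativity and values of the characters\<close>

lemma zeta_power_eq_1: "\<zeta> ^ i = 1 \<longleftrightarrow> m dvd i"
proof
  assume "m dvd i"
  then obtain c where "i = m * c" by (elim dvdE)
  thus "\<zeta> ^ i = 1" using m_pos
    by (simp add: \<zeta>_def power_mult) (simp add: DeMoivre)
next
  assume i: "\<zeta> ^ i = 1"
  have m1: "\<zeta> ^ m = 1" using m_pos by (simp add: \<zeta>_def DeMoivre)
  have "\<zeta> ^ i = \<zeta> ^ (m * (i div m) + i mod m)" by simp
  also have "\<dots> = \<zeta> ^ (i mod m)"
    unfolding power_add power_mult m1 by simp
  finally have *: "\<zeta> ^ (i mod m) = 1" using i by simp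
  have "cis (2 * pi * real (i mod m) / real m) = cis (2 * pi * real 0 / real m)"
    using * by (simp add: \<zeta>_def DeMoivre mult_ac)
  hence "i mod m = 0"
    using m_pos inj_onD[OF bij_betw_imp_inj_on[OF bij_betw_roots_unity[OF m_pos]], of "i mod m" 0]
    by simp
  thus "m dvd i" by auto
qed

lemma zeta_nonzero: "\<zeta> \<noteq> 0"
  by (simp add: \<zeta>_def)

lemma g_nonzero: "g \<noteq> 0"
  using g_power_eq_1[of "q - 1"] q_gt_1 by (auto simp: power_0_left)

lemma g_frob: "g ^ q = g"
  using g_power_eq_1[of "q - 1"] q_gt_1 power_Suc[of g "q - 1"] by simp

lemma omega_power: "\<omega> (g ^ i) = \<zeta> ^ i"
proof -
  have *: "\<zeta> ^ i = \<zeta> ^ j" if "g ^ i = g ^ j" "i \<le> j" for i j :: nat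
  proof -
    have "g ^ i * g ^ (j - i) = g ^ j"
      using that(2) by (simp flip: power_add)
    hence "g ^ i * g ^ (j - i) = g ^ i * 1" using that(1) by simp
    hence "g ^ (j - i) = 1" using g_nonzero by simp
    hence "\<zeta> ^ (j - i) = 1"
      using g_power_eq_1 zeta_power_eq_1 m_dvd dvd_trans by blast
    hence "\<zeta> ^ i * \<zeta> ^ (j - i) = \<zeta> ^ i" by simp
    thus ?thesis using that by (simp flip: power_add)
  qed
  define j where "j = (SOME j. g ^ i = g ^ j)"
  have "g ^ i = g ^ j" unfolding j_def by (rule someI_ex) blast
  hence "\<zeta> ^ j = \<zeta> ^ i" using *[of i j] *[of j i] by (metis nat_le_linear)
  thus ?thesis using g_nonzero by (simp add: \<omega>_def j_def)
qed

lemma omega_0 [simp]: "\<omega> 0 = 0"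
  by (simp add: \<omega>_def)

lemma omega_eq_0_iff: "\<omega> z = 0 \<longleftrightarrow> z = 0"
  by (simp add: \<omega>_def zeta_nonzero)

lemma omega_1: "\<omega> 1 = 1"
  using omega_power[of 0] by simp

lemma omega_mult:
  assumes "x ^ q = x" "y ^ q = y"
  shows "\<omega> (x * y) = \<omega> x * \<omega> y"
proof (cases "x = 0 \<or> y = 0")
  case False
  then obtain i j where "x = g ^ i" "y = g ^ j" using generator assms by metis
  thus ?thesis by (simp add: omega_power flip: power_add)
qed auto

lemma norm_omega_le: "norm (\<omega> z) \<le> 1"
  by (simp add: \<omega>_def \<zeta>_def norm_power)

lemma omega_power_m: "z \<noteq> 0 \<Longrightarrow> \<omega> z ^ m = 1"
  by (simp add: \<omega>_def zeta_power_eq_1 flip: power_mult)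

lemma frob_poly_monics:
  assumes "f \<in> monics d" "\<alpha> \<in> Z"
  shows "poly f \<alpha> ^ q = poly f \<alpha>"
  using frob.poly_map_hom[of f \<alpha>] assms by (simp add: monics_def frob_Z)

lemma chi_mult:
  assumes "f \<in> monics d" "h \<in> monics e"
  shows "\<chi> k (f * h) = \<chi> k f * \<chi> k h"
  unfolding \<chi>_def prod.distrib[symmetric]
  using assms by (intro prod.cong refl) (simp add: omega_mult frob_poly_monics power_mult_distrib)

lemma one_in_monics: "1 \<in> monics 0"
  by (simp add: monics_def)

lemma monics_power: "f \<in> monics d \<Longrightarrow> f ^ j \<in> monics (d * j)"
  by (induction j) (simp_all add: one_in_monics monics_mult)

lemma chi_power:
  assumes "f \<in> monics d"
  shows "\<chi> k (f ^ j) = \<chi> k f ^ j"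
proof (induction j)
  case (Suc j)
  thus ?case using chi_mult[OF assms monics_power[OF assms, of j]] by simp
qed (simp add: \<chi>_def omega_1)

lemma chi_add: "\<chi> (\<lambda>\<alpha>. k \<alpha> + l \<alpha>) f = \<chi> k f * \<chi> l f"
  by (simp add: \<chi>_def power_add prod.distrib)

lemma chi_times: "\<chi> (\<lambda>\<alpha>. t * k \<alpha>) f = \<chi> k f ^ t"
  by (simp add: \<chi>_def prod_power_distrib mult.commute[of t] flip: power_mult)

lemma norm_chi_le: "norm (\<chi> k f) \<le> 1"
  unfolding \<chi>_def prod_norm[symmetric]
  by (intro prod_le_1) (auto simp: norm_power intro!: power_le_one norm_omega_le)

lemma chi_root_of_unity:
  assumes "\<And>\<alpha>. \<alpha> \<in> Z \<Longrightarrow> m dvd t * k \<alpha>" and "\<chi> k f \<noteq> 0"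
  shows "\<chi> k f ^ t = 1"
proof -
  have "(\<omega> (poly f \<alpha>) ^ k \<alpha>) ^ t = 1" if \<alpha>: "\<alpha> \<in> Z" for \<alpha>
  proof (cases "poly f \<alpha> = 0")
    case True
    \<comment> \<open>A zero value with positive exponent would make the whole product 0.\<close>
    hence "k \<alpha> = 0" using assms(2) \<alpha> finite_Z by (auto simp: \<chi>_def)
    thus ?thesis by simp
  next
    case False
    obtain c where "t * k \<alpha> = m * c" using assms(1)[OF \<alpha>] by (elim dvdE)
    hence "(\<omega> (poly f \<alpha>) ^ k \<alpha>) ^ t = (\<omega> (poly f \<alpha>) ^ m) ^ c"
      by (simp add: mult.commute flip: power_mult)
    thus ?thesis using omega_power_m[OF False] by simp
  qed
  thus ?thesis unfolding \<chi>_def prod_power_distrib by (intro prod.neutral) blast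
qed

lemma coeffL_0: "coeffL k 0 = 1"
proof -
  have "monics 0 = {1}" 
    using one_in_monics by (auto simp: monics_def elim!: degree_eq_zeroE)
  thus ?thesis by (simp add: coeffL_def \<chi>_def omega_1)
qed

lemma coeffL_recurrence:
  "of_nat d * coeffL k d = (\<Sum>N=1..d. charsum k N * coeffL k (d - N))"
  unfolding coeffL_def charsum_def by (rule newton_recurrence[OF chi_mult])

lemma norm_charsum_le:
  assumes "N \<ge> 1"
  shows "norm (charsum k N) \<le> real q ^ N"
proof -
  have "norm (charsum k N) \<le> (\<Sum>\<theta>\<in>subfld N. 1)"
    unfolding charsum_def by (intro sum_norm_le norm_chi_le)
  thus ?thesis using card_subfld[of N] assms by simp
qed

text \<open>Multiplying the value at \<open>\<alpha>\<close> by a generator while keeping the values at the other points of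
  \<open>Z\<close> permutes the monic polynomials of degree \<open>d\<close>.\<close>
lemma coeffL_eq_0:
  assumes \<alpha>: "\<alpha> \<in> Z" "\<not> m dvd k \<alpha>" and d: "d \<ge> card Z"
  shows "coeffL k d = 0"
proof -
  \<comment> \<open>The Lagrange basis polynomial that is 1 at \<alpha> and 0 on the rest of
    \<open>Z\<close>. Its degree is below \<open>card Z\<close>, hence below \<open>d\<close>, so
    adding multiples of it keeps a polynomial monic of degree \<open>d\<close>.\<close>
  define l where "l = (\<Prod>\<beta>\<in>Z - {\<alpha>}. smult (1 / (\<alpha> - \<beta>)) [:- \<beta>, 1:])"
  have l1: "poly l \<alpha> = 1"
    unfolding l_def poly_prod by (intro prod.neutral) (auto simp flip: diff_divide_distrib)
  have l0: "poly l \<beta> = 0" if "\<beta> \<in> Z" "\<beta> \<noteq> \<alpha>" for \<beta>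
    unfolding l_def poly_prod using finite_Z that by (intro prod_zero) auto
  have "degree l \<le> card (Z - {\<alpha>})"
  proof -
    have "degree l \<le> (\<Sum>\<beta>\<in>Z - {\<alpha>}. degree (smult (1 / (\<alpha> - \<beta>)) [:- \<beta>, 1:]))"
      unfolding l_def using degree_prod_sum_le[of "Z - {\<alpha>}"] finite_Z by (simp only: o_def) blast
    also have "\<dots> \<le> (\<Sum>\<beta>\<in>Z - {\<alpha>}. 1)"
      by (intro sum_mono order_trans[OF degree_smult_le]) simp
    finally show ?thesis by simp
  qed
  moreover have "card (Z - {\<alpha>}) < card Z" using \<alpha> finite_Z by (metis card_Diff1_less)
  ultimately have deg: "degree l < d" using d by linarith
  have frob_l: "map_poly (\<lambda>x. x ^ q) l = l"
    unfolding l_def frob.map_poly_hom_prod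
    by (intro prod.cong refl poly_eqI) (simp add: power_mult_distrib power_divide frob.hom_diff coeff_pCons frob_Z \<alpha>(1) frob.hom_uminus split: nat.split)
  define T where "T = (\<lambda>w f. f + smult ((w - 1) * poly f \<alpha>) l)"
  have T: "T w f \<in> monics d" if w: "w ^ q = w" and f: "f \<in> monics d" for w f
  proof -
    have "degree (smult ((w - 1) * poly f \<alpha>) l) < degree f"
      using deg f by (auto simp: monics_def)
    hence "degree (T w f) = d" "lead_coeff (T w f) = 1"
      using f coeff_eq_0[OF deg] unfolding T_def by (auto simp: monics_def degree_add_eq_left)
    moreover have "map_poly (\<lambda>x. x ^ q) (smult c l) = smult (c ^ q) l" for c
      using frob_l by (intro poly_eqI) (simp add: power_mult_distrib poly_eq_iff)
    ultimately show ?thesis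
      using f w frob_poly_monics[OF f \<alpha>(1)]
      by (simp add: monics_def T_def frob.map_poly_hom_add power_mult_distrib frob.hom_diff)
  qed
  have T\<alpha>: "poly (T w f) \<alpha> = w * poly f \<alpha>" for w f
    by (simp add: T_def l1 algebra_simps)
  have T\<beta>: "poly (T w f) \<beta> = poly f \<beta>" if "\<beta> \<in> Z" "\<beta> \<noteq> \<alpha>" for w f \<beta>
    by (simp add: T_def l0 that)
  have TT: "T v (T w f) = f" if "v * w = 1" for v w f
  proof -
    have "T v (T w f) = T w f + smult ((v - 1) * poly (T w f) \<alpha>) l"
      by (simp add: T_def)
    also have "\<dots> = f + smult ((w - 1 + (v - 1) * w) * poly f \<alpha>) l"
      unfolding T\<alpha> by (simp add: T_def distrib_right smult_add_left mult.assoc)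
    also have "w - 1 + (v - 1) * w = 0" using that by (simp add: algebra_simps)
    finally show ?thesis by simp
  qed
  have \<chi>T: "\<chi> k (T g f) = \<zeta> ^ k \<alpha> * \<chi> k f" if "f \<in> monics d" for f
  proof -
    have "\<chi> k (T g f) = \<omega> (g * poly f \<alpha>) ^ k \<alpha> * (\<Prod>\<beta>\<in>Z - {\<alpha>}. \<omega> (poly f \<beta>) ^ k \<beta>)"
      unfolding \<chi>_def using T\<beta> by (subst prod.remove[OF finite_Z \<alpha>(1)]) (simp add: T\<alpha>)
    also have "\<omega> (g * poly f \<alpha>) = \<zeta> * \<omega> (poly f \<alpha>)"
      using omega_mult[OF g_frob frob_poly_monics[OF that \<alpha>(1)]] omega_power[of 1] by simp
    finally show ?thesis
      unfolding \<chi>_def by (subst prod.remove[OF finite_Z \<alpha>(1)]) (simp add: power_mult_distrib mult_ac)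
  qed
  have ginv: "inverse g ^ q = inverse g" by (simp add: power_inverse g_frob)
  \<comment> \<open>Reindexing by \<open>T g\<close> multiplies the sum by
    \<open>\<zeta> ^ k \<alpha>\<close>, which differs from 1 because \<open>m\<close> does not
    divide \<open>k \<alpha>\<close>.\<close>
  have "coeffL k d = (\<Sum>f\<in>monics d. \<chi> k (T g f))"
    unfolding coeffL_def
    by (rule sum.reindex_bij_witness[of _ "T g" "T (inverse g)"])
       (use T[OF g_frob] T[OF ginv] TT g_nonzero in auto)
  also have "\<dots> = \<zeta> ^ k \<alpha> * coeffL k d"
    by (simp add: coeffL_def sum_distrib_left \<chi>T)
  finally show ?thesis using \<alpha>(2) zeta_power_eq_1 by auto
qed

text \<open>Points of \<open>Z\<close> are fixed by Frobenius, so agreeing with one conjugate of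
  \<theta> means agreeing with \<theta>.\<close>

lemma poly_charpoly_eq_0_iff:
  assumes "\<alpha> \<in> Z" "N \<ge> 1"
  shows "poly (charpoly N \<theta>) \<alpha> = 0 \<longleftrightarrow> \<theta> = \<alpha>"
proof -
  have per: "\<alpha> ^ (q ^ i) = \<alpha>" for i
    using frob_power_period[of \<alpha> 1 i] frob_Z[OF assms(1)] by (simp add: subfld_def)
  have "poly (charpoly N \<theta>) \<alpha> = 0 \<longleftrightarrow> (\<exists>i<N. \<alpha> = \<theta> ^ (q ^ i))"
    by (auto simp: charpoly_def poly_prod)
  also have "\<dots> \<longleftrightarrow> (\<exists>i<N. \<alpha> ^ (q ^ i) = \<theta> ^ (q ^ i))" by (simp add: per)
  also have "\<dots> \<longleftrightarrow> \<theta> = \<alpha>" using assms(2) frob_power_inj by (metis less_one less_le_trans)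
  finally show ?thesis .
qed

lemma Z_subset_subfld: "Z \<subseteq> subfld N"
  using frob_power_period[of _ 1 N] frob_Z by (auto simp: subfld_def)

text \<open>The summand is 0 for \<theta> in \<open>Z\<close>, by positivity of the weights, and 1
  elsewhere, by divisibility.\<close>

lemma charsum_trivial:
  assumes k: "\<And>\<alpha>. \<alpha> \<in> Z \<Longrightarrow> m dvd k \<alpha>" "\<And>\<alpha>. \<alpha> \<in> Z \<Longrightarrow> k \<alpha> > 0" and N: "N \<ge> 1"
  shows "charsum k N = of_nat (q ^ N) - of_nat (card Z)"
proof -
  have "\<chi> k (charpoly N \<theta>) = (if \<theta> \<in> Z then 0 else 1)" for \<theta>
  proof (cases "\<theta> \<in> Z")
    case True
    thus ?thesis using k(2)[OF True] finite_Z poly_charpoly_eq_0_iff[OF True N]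
      by (auto simp: \<chi>_def omega_eq_0_iff intro!: bexI[of _ \<theta>])
  next
    case False
    hence "\<chi> k (charpoly N \<theta>) \<noteq> 0"
      using finite_Z N by (auto simp: \<chi>_def omega_eq_0_iff poly_charpoly_eq_0_iff)
    thus ?thesis using chi_root_of_unity[of 1 k] k False by simp
  qed
  hence "charsum k N = (\<Sum>\<theta>\<in>subfld N. if \<theta> \<in> Z then 0 else 1)"
    by (simp add: charsum_def)
  also have "\<dots> = of_nat (card (subfld N - Z))"
    using card_subfld[of N] N by (simp add: sum.If_cases Diff_eq)
  also have "\<dots> = of_nat (q ^ N) - of_nat (card Z)"
    using card_subfld[of N] N card_mono[OF _ Z_subset_subfld[of N]]
    by (simp add: card_Diff_subset[OF finite_Z Z_subset_subfld] of_nat_diff)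
  finally show ?thesis .
qed

end

section \<open>L-functions at 1/q and averages of character sums\<close>

context kummer_character begin

lemma L_log_deriv:
  "fps_X * fps_deriv (Abs_fps (coeffL k)) =
   Abs_fps (\<lambda>N. if N = 0 then 0 else charsum k N) * Abs_fps (coeffL k)"
proof (rule fps_ext)
  fix n
  have "(fps_X * fps_deriv (Abs_fps (coeffL k))) $ n = of_nat n * coeffL k n"
    by (cases n) simp_all
  also have "\<dots> = (\<Sum>N\<in>{1..n}. (if N = 0 then 0 else charsum k N) * coeffL k (n - N))"
    unfolding coeffL_recurrence by (intro sum.cong) auto
  also have "\<dots> = (\<Sum>N\<in>{0..n}. (if N = 0 then 0 else charsum k N) * coeffL k (n - N))"
    by (intro sum.mono_neutral_left) auto
  finally show "(fps_X * fps_deriv (Abs_fps (coeffL k))) $ n =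
      (Abs_fps (\<lambda>N. if N = 0 then 0 else charsum k N) * Abs_fps (coeffL k)) $ n"
    by (simp add: fps_mult_nth)
qed

text \<open>By \<open>charsum_trivial\<close> the L-function is (1 - X)^s / (1 - q X) with s =
  \<open>card Z\<close>: a zeta function without the Euler factors at \<open>Z\<close>. Its product
  \<open>G\<close> with 1 - q X is identified by the differential equation of (1 - X)^s.\<close>

lemma L_trivial:
  assumes k: "\<And>\<alpha>. \<alpha> \<in> Z \<Longrightarrow> m dvd k \<alpha>" "\<And>\<alpha>. \<alpha> \<in> Z \<Longrightarrow> k \<alpha> > 0"
  shows "\<exists>r. fps_of_poly [:1, - of_nat q:] * Abs_fps (coeffL k) = fps_of_poly r"
proof -
  define L where "L = Abs_fps (coeffL k)"
  define S where "S = Abs_fps (\<lambda>N. if N = 0 then 0 else charsum k N)"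
  define c where "c = fps_const (of_nat q :: complex)"
  define s where "s = (of_nat (card Z) :: complex fps)"
  have s: "s = fps_const (of_nat (card Z))" by (simp add: s_def fps_of_nat)
  have qX: "fps_of_poly [:1, - of_nat q:] = 1 - c * (fps_X :: complex fps)"
    by (simp add: c_def fps_of_poly_pCons algebra_simps flip: fps_const_neg)
  have ode: "fps_X * fps_deriv L = S * L"
    unfolding L_def S_def by (rule L_log_deriv)
  have S: "(1 - fps_X) * ((1 - c * fps_X) * S) = c * fps_X * (1 - fps_X) - s * fps_X * (1 - c * fps_X)"
  proof -
    define E1 where "E1 = Abs_fps (\<lambda>N. of_nat q ^ N :: complex)"
    define E2 where "E2 = Abs_fps (\<lambda>N. 1 :: complex)"
    have E1: "(1 - c * fps_X) * E1 = 1"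
    proof (rule fps_ext)
      fix n show "((1 - c * fps_X) * E1) $ n = (1 :: complex fps) $ n"
        by (cases n) (simp_all add: E1_def c_def left_diff_distrib mult.assoc)
    qed
    have E2: "(1 - fps_X) * E2 = 1"
    proof (rule fps_ext)
      fix n show "((1 - fps_X) * E2) $ n = (1 :: complex fps) $ n"
        by (cases n) (simp_all add: E2_def left_diff_distrib)
    qed
    have S_eq: "S = (E1 - 1) - s * (E2 - 1)"
    proof (rule fps_ext)
      fix n show "S $ n = ((E1 - 1) - s * (E2 - 1)) $ n"
        using charsum_trivial[of k n] k by (auto simp: S_def E1_def E2_def s)
    qed
    have "(1 - fps_X) * ((1 - c * fps_X) * S) =
       (1 - fps_X) * ((1 - c * fps_X) * E1 - (1 - c * fps_X)) -
       s * (1 - c * fps_X) * ((1 - fps_X) * E2 - (1 - fps_X))"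
      unfolding S_eq by (simp add: algebra_simps)
    thus ?thesis unfolding E1 E2 by (simp add: algebra_simps)
  qed
  define G where "G = (1 - c * fps_X) * L"
  have dG: "fps_deriv G = (1 - c * fps_X) * fps_deriv L - c * L"
    by (simp add: G_def c_def algebra_simps)
  have "fps_X * ((1 - fps_X) * fps_deriv G) =
      (1 - fps_X) * ((1 - c * fps_X) * (fps_X * fps_deriv L)) - c * fps_X * (1 - fps_X) * L"
    unfolding dG by (simp add: algebra_simps)
  also have "\<dots> = ((1 - fps_X) * ((1 - c * fps_X) * S)) * L - c * fps_X * (1 - fps_X) * L"
    unfolding ode by (simp only: mult.assoc)
  also have "\<dots> = fps_X * (- s * G)"
    unfolding S G_def by (simp add: algebra_simps)
  finally have "(1 - fps_X) * fps_deriv G = - of_nat (card Z) * G"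
    unfolding s_def by (simp only: mult_cancel_left) simp
  thus ?thesis
    using fps_poly_of_ode unfolding qX G_def L_def by blast
qed

lemma L_nontrivial_poly:
  assumes \<alpha>: "\<alpha> \<in> Z" "\<not> m dvd k \<alpha>"
  shows "Abs_fps (coeffL k) = fps_of_poly (\<Sum>d<card Z. monom (coeffL k d) d)"
  by (rule fps_ext) (auto simp: coeff_sum coeffL_eq_0[where \<alpha> = \<alpha>] \<alpha>)

text \<open>Some \<theta> outside \<open>Z\<close> has a nonzero value whose t-th power is 1, and
  multiplying the degree by \<open>t\<close> raises the value to the t-th power. This supplies a
  nonzero coefficient of the combined logarithmic derivative.\<close>

lemma exists_charpoly_value_1:
  assumes "t > 0" "\<And>\<alpha>. \<alpha> \<in> Z \<Longrightarrow> m dvd t * k \<alpha>"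
  shows "\<exists>N>0. \<exists>\<theta>\<in>subfld N. \<chi> k (charpoly N \<theta>) = 1"
proof -
  define e where "e = Suc (card Z)"
  have "card Z < card (subfld e)"
    using card_subfld(2)[of e] q_gt_1 less_exp[of e] power_mono[of 2 q e]
    unfolding e_def by linarith
  then obtain \<theta> where \<theta>: "\<theta> \<in> subfld e" "\<theta> \<notin> Z"
    using finite_Z by (metis card_mono linorder_not_le subsetI)
  have "\<chi> k (charpoly e \<theta>) \<noteq> 0"
    using finite_Z \<theta> by (auto simp: \<chi>_def omega_eq_0_iff poly_charpoly_eq_0_iff e_def)
  hence "\<chi> k (charpoly (e * t) \<theta>) = 1"
    using chi_root_of_unity[OF assms(2)] chi_power[OF charpoly_in_monics[OF \<theta>(1)]]
    by (simp add: charpoly_mult_degree[OF \<theta>(1)])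
  moreover have "\<theta> \<in> subfld (e * t)"
    using frob_power_period[OF \<theta>(1), of t] by (simp add: subfld_def)
  ultimately show ?thesis using assms(1) by (intro exI[of _ "e * t"]) (auto simp: e_def)
qed

text \<open>With \<open>u\<close> the formal order of the character, the powers 1, ..., u - 1 are
  nontrivial and have polynomial L-functions, while the u-th is trivial. The combined logarithmic
  derivative counts the \<theta> with value 1 and so is nonnegative.\<close>

lemma L_nonvanishing:
  assumes \<alpha>: "\<alpha> \<in> Z" "\<not> m dvd k \<alpha>" and pos: "\<And>\<alpha>. \<alpha> \<in> Z \<Longrightarrow> k \<alpha> > 0"
  shows "(\<Sum>d<card Z. coeffL k d / of_nat q ^ d) \<noteq> 0"
proof -
  define P where "P = (\<lambda>t. t > 0 \<and> (\<forall>\<alpha>\<in>Z. m dvd t * k \<alpha>))"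
  define u where "u = (LEAST t. P t)"
  have "P m" using m_pos by (auto simp: P_def)
  hence u: "u > 0" "\<And>\<alpha>. \<alpha> \<in> Z \<Longrightarrow> m dvd u * k \<alpha>"
    using LeastI[of P m] by (auto simp: u_def P_def)
  have less_u: "\<not> P t" if "t < u" for t
    using not_less_Least[of t P] that by (simp add: u_def)
  have "\<not> P 1" using \<alpha> by (auto simp: P_def)
  hence "u \<noteq> 1" using u by (auto simp: P_def)
  hence u2: "u \<ge> 2" using u(1) by linarith
  define kt where "kt = (\<lambda>t \<alpha>. t * k \<alpha>)"
  define S where "S = (\<lambda>t. Abs_fps (\<lambda>N. if N = 0 then 0 else charsum (kt t) N))"
  have "\<exists>r. fps_of_poly [:1, - of_nat q:] * Abs_fps (coeffL (kt u)) = fps_of_poly r"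
    using u pos by (intro L_trivial) (auto simp: kt_def)
  then obtain r where r: "fps_of_poly [:1, - of_nat q:] * Abs_fps (coeffL (kt u)) = fps_of_poly r"
    by blast
  \<comment> \<open>The first \<open>u\<close> powers of a character value sum to \<open>u\<close>
    if the value is 1 and to 0 otherwise, the value 0 included.\<close>
  have sumS: "(\<Sum>t=1..u. S t $ N) = of_nat u * of_nat (card {\<theta> \<in> subfld N. \<chi> k (charpoly N \<theta>) = 1})"
    if "N > 0" for N
  proof -
    have pt: "(\<Sum>t=1..u. \<chi> k f ^ t) = (if \<chi> k f = 1 then of_nat u else 0)" for f
    proof (cases "\<chi> k f = 0")
      case True
      hence "(\<Sum>t=1..u. \<chi> k f ^ t) = 0" by (intro sum.neutral) auto
      thus ?thesis using True by simp
    next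
      case False
      thus ?thesis by (intro sum_powers_root_of_unity chi_root_of_unity u)
    qed
    have "(\<Sum>t=1..u. S t $ N) = (\<Sum>t=1..u. \<Sum>\<theta>\<in>subfld N. \<chi> k (charpoly N \<theta>) ^ t)"
      using that by (simp add: S_def charsum_def kt_def chi_times)
    also have "\<dots> = (\<Sum>\<theta>\<in>subfld N. \<Sum>t=1..u. \<chi> k (charpoly N \<theta>) ^ t)"
      by (rule sum.swap)
    also have "\<dots> = (\<Sum>\<theta>\<in>subfld N. if \<chi> k (charpoly N \<theta>) = 1 then of_nat u else 0)"
      by (simp only: pt)
    also have "\<dots> = of_nat u * of_nat (card {\<theta> \<in> subfld N. \<chi> k (charpoly N \<theta>) = 1})"
      using card_subfld(1)[OF that] by (simp add: sum.If_cases Int_def)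
    finally show ?thesis .
  qed
  obtain j \<theta> where j: "j > 0" "\<theta> \<in> subfld j" "\<chi> k (charpoly j \<theta>) = 1"
    using exists_charpoly_value_1[of u k] u by blast
  define L where "L = (\<lambda>t. Abs_fps (coeffL (kt t)))"
  define p where "p = (\<lambda>t. \<Sum>d<card Z. monom (coeffL (kt t) d) d)"
  have Lp: "L t = fps_of_poly (p t)" if t: "t \<in> {1..<u}" for t
  proof -
    obtain \<beta> where "\<beta> \<in> Z" "\<not> m dvd kt t \<beta>"
      using less_u[of t] t by (auto simp: P_def kt_def)
    thus ?thesis unfolding L_def p_def by (rule L_nontrivial_poly)
  qed
  have nonneg: "(\<Sum>t=1..u. S t $ n) \<in> \<real>\<^sub>\<ge>\<^sub>0" for n
    using sumS[of n] by (cases "n = 0") (simp_all add: S_def flip: of_nat_mult)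
  have "card {\<theta> \<in> subfld j. \<chi> k (charpoly j \<theta>) = 1} \<noteq> 0"
    using j card_subfld(1)[OF j(1)] by auto
  hence Sj: "(\<Sum>t=1..u. S t $ j) \<noteq> 0"
    using sumS[OF j(1)] u(1) by simp
  have "poly (p 1) (1 / of_nat q) \<noteq> 0"
  proof (rule nonvanishing_of_nonneg_log_deriv[of u L S p "of_nat q" r j])
    show "fps_X * fps_deriv (L t) = S t * L t" for t
      unfolding L_def S_def by (rule L_log_deriv)
    show "L t $ 0 = 1" for t
      by (simp add: L_def coeffL_0)
    show "fps_of_poly [:1, - of_nat q:] * L u = fps_of_poly r"
      unfolding L_def by (rule r)
    show "of_nat q \<noteq> (0 :: complex)" using q_gt_1 by simp
  qed (fact u2 Lp nonneg Sj j(1))+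
  thus ?thesis
    by (simp add: p_def kt_def poly_sum poly_monom power_one_over)
qed

text \<open>In the trivial case each normalised sum is 1 minus a geometrically decaying term. In the
  nontrivial case the L-function does not vanish at 1/q, and the recurrence bounds the partial
  sums.\<close>

lemma charsum_average:
  assumes pos: "\<And>\<alpha>. \<alpha> \<in> Z \<Longrightarrow> k \<alpha> > 0"
  shows "\<exists>C. \<forall>Y. norm ((\<Sum>N=1..Y. charsum k N / of_nat q ^ N) -
           (if \<forall>\<alpha>\<in>Z. m dvd k \<alpha> then of_nat Y else 0)) \<le> C"
proof (cases "\<forall>\<alpha>\<in>Z. m dvd k \<alpha>")
  case True
  have "norm ((\<Sum>N=1..Y. charsum k N / of_nat q ^ N) - of_nat Y) \<le> real (card Z)" for Y
  proof -
    have q: "real q \<ge> 2" using q_gt_1 by simp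
    have "(\<Sum>N=1..Y. charsum k N / of_nat q ^ N) = (\<Sum>N=1..Y. 1 - of_nat (card Z) / of_nat q ^ N)"
      using True pos q_gt_1 by (intro sum.cong refl) (simp add: charsum_trivial diff_divide_distrib)
    hence "norm ((\<Sum>N=1..Y. charsum k N / of_nat q ^ N) - of_nat Y) =
           norm (\<Sum>N=1..Y. (of_nat (card Z) / of_nat q ^ N :: complex))"
      by (simp add: sum_subtractf norm_minus_commute)
    also have "\<dots> \<le> (\<Sum>N=1..Y. real (card Z) / 2 ^ N)"
    proof (intro sum_norm_le)
      fix N
      have "real (card Z) / real q ^ N \<le> real (card Z) / 2 ^ N"
        using power_mono[OF q, of N] by (intro frac_le) auto
      thus "norm (of_nat (card Z) / of_nat q ^ N :: complex) \<le> real (card Z) / 2 ^ N"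
        by (simp add: norm_divide norm_power)
    qed
    also have "\<dots> = real (card Z) * (\<Sum>N=1..Y. (1/2) ^ N)"
      by (simp add: sum_distrib_left power_one_over)
    also have "(\<Sum>N=1..Y. (1/2) ^ N) = 1 - (1/2 :: real) ^ Y"
      by (induction Y) auto
    also have "real (card Z) * \<dots> \<le> real (card Z) * 1"
      by (intro mult_left_mono) auto
    finally show ?thesis by simp
  qed
  thus ?thesis using True by auto
next
  case False
  then obtain \<alpha> where \<alpha>: "\<alpha> \<in> Z" "\<not> m dvd k \<alpha>" by blast
  have "\<exists>C. \<forall>Y. norm (\<Sum>N=1..Y. charsum k N / of_real (real q) ^ N) \<le> C"
  proof (rule recurrence_partial_sums_bounded)
    show "coeffL k d = 0" if "d \<ge> card Z" for d using coeffL_eq_0[where \<alpha> = \<alpha>] \<alpha> that by blast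
    show "(\<Sum>d<card Z. coeffL k d / of_real (real q) ^ d) \<noteq> 0"
      using L_nonvanishing[of \<alpha> k] \<alpha> pos by simp
  qed (use q_gt_1 norm_charsum_le coeffL_recurrence in auto)
  thus ?thesis using False by auto
qed

text \<open>Both conditions are expanded in m^2 characters. The trivial ones give the main term,
  since \<open>ann\<close> makes their weights equal to 1. So the normalised counts are at least
  1/m^2 in the mean, and half of this is reached infinitely often.\<close>

lemma infinitely_many_prescribed_values:
  assumes pos: "\<And>\<alpha>. \<alpha> \<in> Z \<Longrightarrow> e \<alpha> + f \<alpha> > 0"
    and ann: "\<And>i j. (\<forall>\<alpha>\<in>Z. m dvd i * e \<alpha> + j * f \<alpha>) \<Longrightarrow> m dvd i * x + j * y"
  shows "\<exists>\<^sub>\<infinity>N. real (card {\<theta> \<in> subfld N. \<chi> e (charpoly N \<theta>) = \<zeta> ^ x \<and> \<chi> f (charpoly N \<theta>) = \<zeta> ^ y})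
            \<ge> real q ^ N / (2 * real m ^ 2)"
proof -
  define G where "G = (\<lambda>N. {\<theta> \<in> subfld N. \<chi> e (charpoly N \<theta>) = \<zeta> ^ x \<and> \<chi> f (charpoly N \<theta>) = \<zeta> ^ y})"
  define kk where "kk = (\<lambda>(i, j) \<alpha>. i * e \<alpha> + j * f \<alpha>)"
  \<comment> \<open>The exponents run through 1, ..., m instead of 0, ..., m - 1 so that every
    weight \<open>kk p \<alpha>\<close> is positive, as \<open>charsum_average\<close>
    requires.\<close>
  define I where "I = {1..m} \<times> {1..m}"
  define w where "w = (\<lambda>(i, j). inverse (\<zeta> ^ (i * x + j * y)))"
  define \<Gamma> where "\<Gamma> = {p \<in> I. \<forall>\<alpha>\<in>Z. m dvd kk p \<alpha>}"
  have root: "\<chi> k h ^ m = 1" if "\<chi> k h \<noteq> 0" for k h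
    using that by (intro chi_root_of_unity) auto
  have orth: "(\<Sum>i=1..m. (\<chi> k h * inverse (\<zeta> ^ z)) ^ i) = (if \<chi> k h = \<zeta> ^ z then of_nat m else 0)" for k h z
  proof (cases "\<chi> k h = 0")
    case True
    hence "(\<Sum>i=1..m. (\<chi> k h * inverse (\<zeta> ^ z)) ^ i) = 0"
      by (intro sum.neutral) auto
    thus ?thesis using True zeta_nonzero by simp
  next
    case False
    have "(\<zeta> ^ z) ^ m = 1" by (simp add: zeta_power_eq_1 flip: power_mult)
    hence "(\<chi> k h * inverse (\<zeta> ^ z)) ^ m = 1"
      using root[OF False] by (simp add: power_mult_distrib power_inverse)
    from sum_powers_root_of_unity[OF this] show ?thesis
      using zeta_nonzero by (auto simp: field_simps)
  qed
  have count: "of_nat (m ^ 2 * card (G N)) = (\<Sum>p\<in>I. w p * charsum (kk p) N)" if "N > 0" for N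
  proof -
    have "(\<Sum>p\<in>I. w p * charsum (kk p) N) =
      (\<Sum>p\<in>I. \<Sum>\<theta>\<in>subfld N. (\<chi> e (charpoly N \<theta>) * inverse (\<zeta> ^ x)) ^ fst p * (\<chi> f (charpoly N \<theta>) * inverse (\<zeta> ^ y)) ^ snd p)"
      unfolding charsum_def sum_distrib_left
      by (intro sum.cong refl)
         (auto simp: w_def kk_def chi_add chi_times power_mult_distrib power_add mult_ac power_inverse simp flip: power_mult)
    also have "\<dots> = (\<Sum>\<theta>\<in>subfld N. \<Sum>p\<in>I. (\<chi> e (charpoly N \<theta>) * inverse (\<zeta> ^ x)) ^ fst p * (\<chi> f (charpoly N \<theta>) * inverse (\<zeta> ^ y)) ^ snd p)"
      by (rule sum.swap)
    also have "\<dots> = (\<Sum>\<theta>\<in>subfld N. (\<Sum>i=1..m. (\<chi> e (charpoly N \<theta>) * inverse (\<zeta> ^ x)) ^ i) * (\<Sum>j=1..m. (\<chi> f (charpoly N \<theta>) * inverse (\<zeta> ^ y)) ^ j))"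
      unfolding I_def sum_product by (simp add: sum.cartesian_product case_prod_beta)
    also have "\<dots> = (\<Sum>\<theta>\<in>subfld N. if \<theta> \<in> G N then of_nat (m ^ 2) else 0)"
      unfolding orth by (intro sum.cong refl) (simp add: G_def power2_eq_square)
    also have "\<dots> = of_nat (m ^ 2 * card (G N))"
      using card_subfld(1)[OF that] by (simp add: sum.If_cases G_def Int_def mult.commute)
    finally show ?thesis by simp
  qed
  have "\<exists>C. \<forall>Y. norm ((\<Sum>N=1..Y. charsum (kk p) N / of_nat q ^ N) -
           (if \<forall>\<alpha>\<in>Z. m dvd kk p \<alpha> then of_nat Y else 0)) \<le> C" if "p \<in> I" for p
  proof (rule charsum_average)
    fix \<alpha> assume "\<alpha> \<in> Z"
    from pos[OF this] that show "kk p \<alpha> > 0" by (auto simp: kk_def I_def)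
  qed
  then obtain C where C: "\<And>p Y. p \<in> I \<Longrightarrow> norm ((\<Sum>N=1..Y. charsum (kk p) N / of_nat q ^ N) -
           (if \<forall>\<alpha>\<in>Z. m dvd kk p \<alpha> then of_nat Y else 0)) \<le> C p"
    by metis
  define D where "D = (\<Sum>p\<in>I. C p)"
  have w1: "w p = 1" if "p \<in> \<Gamma>" for p
    using that ann zeta_power_eq_1 by (cases p) (auto simp: \<Gamma>_def w_def kk_def)
  have normw: "norm (w p) = 1" for p
    by (cases p) (simp add: w_def norm_inverse norm_power \<zeta>_def)
  have finI: "finite I" by (simp add: I_def)
  have lower: "real m ^ 2 * (\<Sum>N=1..Y. real (card (G N)) / real q ^ N) \<ge> real Y - D" for Y
  proof -
    define T where "T = real m ^ 2 * (\<Sum>N=1..Y. real (card (G N)) / real q ^ N)"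
    have "complex_of_real T = (\<Sum>N=1..Y. of_nat (m ^ 2 * card (G N)) / of_nat q ^ N)"
      by (simp add: T_def sum_distrib_left)
    also have "\<dots> = (\<Sum>N=1..Y. \<Sum>p\<in>I. w p * (charsum (kk p) N / of_nat q ^ N))"
      by (intro sum.cong refl) (simp add: count sum_divide_distrib del: of_nat_mult)
    also have "\<dots> = (\<Sum>p\<in>I. w p * (\<Sum>N=1..Y. charsum (kk p) N / of_nat q ^ N))"
      unfolding sum_distrib_left by (rule sum.swap)
    finally have T: "complex_of_real T = \<dots>" .
    have "(\<Sum>p\<in>I. w p * (if \<forall>\<alpha>\<in>Z. m dvd kk p \<alpha> then of_nat Y else 0)) = (\<Sum>p\<in>\<Gamma>. of_nat Y)"
      unfolding \<Gamma>_def sum.inter_filter[OF finI]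
      by (intro sum.cong refl) (use w1 in \<open>auto simp: \<Gamma>_def\<close>)
    hence "complex_of_real T - of_nat (card \<Gamma> * Y) =
       (\<Sum>p\<in>I. w p * ((\<Sum>N=1..Y. charsum (kk p) N / of_nat q ^ N) - (if \<forall>\<alpha>\<in>Z. m dvd kk p \<alpha> then of_nat Y else 0)))"
      unfolding T by (simp add: right_diff_distrib sum_subtractf)
    also have "norm \<dots> \<le> D"
      unfolding D_def by (intro sum_norm_le) (simp only: norm_mult normw mult_1_left C)
    finally have "norm (complex_of_real (T - real (card \<Gamma> * Y))) \<le> D" by simp
    hence "\<bar>T - real (card \<Gamma> * Y)\<bar> \<le> D" by (simp only: norm_of_real)
    \<comment> \<open>This pair always gives a trivial character, so the main term is at least
      \<open>Y\<close>.\<close>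
    moreover have "(m, m) \<in> \<Gamma>" using m_pos by (auto simp: \<Gamma>_def I_def kk_def)
    hence "card \<Gamma> \<ge> 1" using finI by (auto simp: \<Gamma>_def Suc_le_eq card_gt_0_iff)
    hence "real Y \<le> real (card \<Gamma> * Y)" by (cases "card \<Gamma>") auto
    ultimately show ?thesis unfolding T_def by linarith
  qed
  show ?thesis
  proof (rule ccontr)
    assume "\<not> ?thesis"
    then obtain M where M: "\<And>N. N > M \<Longrightarrow> real (card (G N)) < real q ^ N / (2 * real m ^ 2)"
      unfolding INFM_nat G_def by (meson not_le)
    \<comment> \<open>Beyond \<open>M\<close> each term stays below 1/(2 m^2), so the total would
      grow at no more than half the rate given by \<open>lower\<close>.\<close>
    have term_le: "real (card (G N)) / real q ^ N \<le> (if N \<le> M then 1 else 0) + 1 / (2 * real m ^ 2)" if "N \<ge> 1" for N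
    proof (cases "N \<le> M")
      case True
      have "card (G N) \<le> q ^ N"
        using card_subfld[of N] that card_mono[of "subfld N" "G N"] by (auto simp: G_def)
      hence "real (card (G N)) \<le> real q ^ N" by (metis of_nat_le_iff of_nat_power)
      hence "real (card (G N)) / real q ^ N \<le> 1" using q_gt_1 by simp
      thus ?thesis using True by (simp add: add_increasing2)
    next
      case False
      thus ?thesis using M[of N] q_gt_1 by (simp add: field_simps)
    qed
    have "real Y - D \<le> real m ^ 2 * real M + real Y / 2" for Y
    proof -
      have "(\<Sum>N=1..Y. real (card (G N)) / real q ^ N) \<le> (\<Sum>N=1..Y. (if N \<le> M then 1 else 0) + 1 / (2 * real m ^ 2))"
        by (intro sum_mono term_le) auto
      also have "\<dots> = real (card ({1..Y} \<inter> {N. N \<le> M})) + real Y / (2 * real m ^ 2)"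
        by (simp add: sum.distrib sum.If_cases)
      also have "card ({1..Y} \<inter> {N. N \<le> M}) \<le> card {1..M}"
        by (intro card_mono) auto
      finally have "(\<Sum>N=1..Y. real (card (G N)) / real q ^ N) \<le> real M + real Y / (2 * real m ^ 2)"
        by simp
      hence "real m ^ 2 * (\<Sum>N=1..Y. real (card (G N)) / real q ^ N) \<le> real m ^ 2 * (real M + real Y / (2 * real m ^ 2))"
        by (intro mult_left_mono) auto
      also have "\<dots> = real m ^ 2 * real M + real Y / 2"
        using m_pos by (simp add: distrib_left)
      finally show ?thesis using lower[of Y] by linarith
    qed
    hence bound: "real Y \<le> 2 * (real m ^ 2 * real M + D)" for Y
      by (smt (verit) field_sum_of_halves)
    obtain Y :: nat where "real Y > 2 * (real m ^ 2 * real M + D)"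
      using reals_Archimedean2 by blast
    thus False using bound[of Y] by linarith
  qed
qed

end

section \<open>Finite fields inside their algebraic closure\<close>

lemma card_power_eq_self:
  fixes x :: "'a :: {finite, field}"
  shows "x ^ CARD('a) = x"
proof (cases "x = 0")
  case False
  define P where "P = \<Prod>(UNIV - {0 :: 'a})"
  have "P = (\<Prod>y\<in>UNIV - {0}. x * y)"
    unfolding P_def
    by (rule prod.reindex_bij_witness[of _ "\<lambda>y. x * y" "\<lambda>y. y / x"]) (use False in auto)
  also have "\<dots> = x ^ (CARD('a) - 1) * P"
    by (simp add: P_def prod.distrib)
  finally have "x ^ (CARD('a) - 1) = 1" by (simp add: P_def)
  thus ?thesis using power_Suc[of x "CARD('a) - 1"] by simp
qed simp

lemma of_nat_card_eq_0: "of_nat CARD('a) = (0 :: 'a :: {finite, field})"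
proof -
  have "(\<Sum>x::'a\<in>UNIV. x + 1) = (\<Sum>x\<in>UNIV. x)"
    by (rule sum.reindex_bij_witness[of _ "\<lambda>x. x - 1" "\<lambda>x. x + 1"]) auto
  thus ?thesis by (simp add: sum.distrib)
qed

interpretation to_ac_hom: coeff_hom "to_ac :: 'a :: field \<Rightarrow> 'a alg_closure"
  by standard simp_all

lemma to_ac_power_card: "to_ac c ^ CARD('a) = to_ac (c :: 'a :: {finite, field})"
  by (simp add: card_power_eq_self flip: to_ac_power)

text \<open>Both sides of \<open>(1 + X)^q = 1 + X^q\<close> are monic of degree \<open>q\<close> and agree at all \<open>q\<close> elements of
  the field, so the identity holds for polynomials and hence in every extension.\<close>
lemma frobenius_alg_closure:
  fixes x y :: "'a :: {finite, field} alg_closure"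
  shows "(x + y) ^ CARD('a) = x ^ CARD('a) + y ^ CARD('a)"
proof -
  define q where "q = CARD('a)"
  have q: "q > 0" by (simp add: q_def)
  have "[:1, 1:] ^ q = monom 1 q + (1 :: 'a poly)"
  proof (rule poly_eqI_degree_lead_coeff[where n = q and A = UNIV])
    have "lead_coeff ([:1, 1:] ^ q :: 'a poly) = 1" by (simp add: lead_coeff_power)
    thus "coeff ([:1, 1:] ^ q) q = coeff (monom 1 q + (1 :: 'a poly)) q"
      using q by (simp add: degree_power_eq)
    show "degree ([:1, 1:] ^ q :: 'a poly) \<le> q" by (simp add: degree_power_eq)
    show "degree (monom 1 q + (1 :: 'a poly)) \<le> q"
      by (intro degree_add_le) (simp_all add: degree_monom_le)
    show "poly ([:1, 1:] ^ q) z = poly (monom 1 q + 1) z" for z :: 'a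
      by (simp add: poly_monom q_def card_power_eq_self)
  qed (simp add: q_def)
  hence "map_poly to_ac ([:1, 1:] ^ q :: 'a poly) = map_poly to_ac (monom 1 q + 1)" by simp
  hence eq: "[:1, 1:] ^ q = monom 1 q + (1 :: 'a alg_closure poly)"
    by (simp add: to_ac_hom.map_poly_hom_power to_ac_hom.map_poly_hom_pCons
        to_ac_hom.map_poly_hom_add map_poly_monom)
  have *: "(1 + z) ^ q = z ^ q + 1" for z :: "'a alg_closure"
    using arg_cong[OF eq, of "\<lambda>p. poly p z"] by (simp add: poly_monom)
  show ?thesis unfolding q_def[symmetric]
  proof (cases "y = 0")
    case False
    hence "(x + y) ^ q = y ^ q * (1 + x / y) ^ q"
      by (simp add: field_simps flip: power_mult_distrib)
    also have "\<dots> = x ^ q + y ^ q" unfolding * using False by (simp add: field_simps power_divide)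
    finally show "(x + y) ^ q = x ^ q + y ^ q" .
  qed (use q in simp)
qed

lemma frobenius_card_power:
  fixes Z :: "'a :: {finite, field} alg_closure set"
  assumes "M > 0" "finite Z" "\<And>\<alpha>. \<alpha> \<in> Z \<Longrightarrow> \<alpha> ^ (CARD('a) ^ M) = \<alpha>"
  shows "frobenius (CARD('a) ^ M) Z"
proof
  have "CARD('a) > 1"
    using card_mono[of UNIV "{0, 1 :: 'a}"] by simp
  thus "CARD('a) ^ M > 1" using assms(1) by (intro one_less_power)
  have "of_nat CARD('a) = (0 :: 'a alg_closure)"
    by (metis of_nat_card_eq_0 to_ac_0 to_ac_of_nat)
  thus "of_nat (CARD('a) ^ M) = (0 :: 'a alg_closure)" using assms(1) by simp
  show "(x + y) ^ CARD('a) ^ M = x ^ CARD('a) ^ M + y ^ CARD('a) ^ M" for x y :: "'a alg_closure"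
    by (induction M) (simp_all add: power_mult mult.commute[of "CARD('a)"] frobenius_alg_closure)
qed (use assms in auto)

section \<open>Cyclicity of the multiplicative group of the fixed field\<close>

context frobenius begin

lemma exists_generator:
  "\<exists>g :: 'k. (\<forall>z. z ^ q = z \<and> z \<noteq> 0 \<longrightarrow> (\<exists>i :: nat. z = g ^ i)) \<and> (\<forall>i :: nat. g ^ i = 1 \<longleftrightarrow> (q - 1) dvd i)"
proof -
  define F where "F = subfld 1"
  have F: "x \<in> F \<longleftrightarrow> x ^ q = x" for x by (simp add: F_def subfld_def)
  have finF: "finite F" and cardF: "card F = q"
    using card_subfld[of 1] by (simp_all add: F_def)
  define R where "R = (\<lparr> carrier = F, monoid.mult = (*), one = 1, ring.zero = 0, add = (+) \<rparr> :: 'k ring)"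
  have "field R"
  proof (rule cring.cring_fieldI2)
    show "cring R"
    proof (rule cringI)
      show "abelian_group R"
      proof (rule abelian_groupI)
        fix x assume "x \<in> carrier R"
        thus "\<exists>y\<in>carrier R. y \<oplus>\<^bsub>R\<^esub> x = \<zero>\<^bsub>R\<^esub>"
          by (intro bexI[of _ "- x"]) (auto simp: R_def F frob.hom_uminus)
      qed (use q_gt_1 in \<open>auto simp: R_def F frob_add\<close>)
      show "comm_monoid R"
        by (rule comm_monoidI) (auto simp: R_def F power_mult_distrib)
    qed (auto simp: R_def algebra_simps)
    show "\<zero>\<^bsub>R\<^esub> \<noteq> \<one>\<^bsub>R\<^esub>" by (simp add: R_def)
    fix x assume "x \<in> carrier R" "x \<noteq> \<zero>\<^bsub>R\<^esub>"
    thus "\<exists>y\<in>carrier R. x \<otimes>\<^bsub>R\<^esub> y = \<one>\<^bsub>R\<^esub>"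
      by (intro bexI[of _ "inverse x"]) (auto simp: R_def F power_inverse)
  qed
  then interpret R: field R .
  have pow: "x [^]\<^bsub>R\<^esub> i = x ^ i" for x and i :: nat
    by (induction i) (simp_all add: R_def nat_pow_def mult.commute)
  obtain g where g: "g \<in> carrier (mult_of R)" "carrier (mult_of R) = {g [^]\<^bsub>R\<^esub> i |i :: nat. i \<in> UNIV}"
    using R.finite_field_mult_group_has_gen finF by (auto simp: R_def)
  have Rs: "carrier R = F" "\<zero>\<^bsub>R\<^esub> = 0" by (simp_all add: R_def)
  have "F - {0} = {g ^ i |i :: nat. i \<in> UNIV}"
    using g(2) unfolding pow carrier_mult_of Rs .
  hence carr: "F - {0} = range (\<lambda>i :: nat. g ^ i)" by blast
  have "g \<in> F - {0}" using g(1) unfolding carrier_mult_of Rs .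
  hence "g * g ^ (q - 1) = g * 1" "g \<noteq> 0" using q_gt_1 by (simp_all add: F flip: power_Suc)
  hence g1: "g ^ (q - 1) = 1" by simp
  have mod_eq: "g ^ i = g ^ (i mod d)" if "g ^ d = 1" for i d
  proof -
    have "g ^ i = g ^ (d * (i div d) + i mod d)" by simp
    also have "\<dots> = g ^ (i mod d)" unfolding power_add power_mult that by simp
    finally show ?thesis .
  qed
  have "g ^ i = 1 \<longleftrightarrow> (q - 1) dvd i" for i
  proof
    assume i: "g ^ i = 1"
    define d where "d = i mod (q - 1)"
    have d: "g ^ d = 1" "d < q - 1" using mod_eq[OF g1, of i] i q_gt_1 by (auto simp: d_def)
    \<comment> \<open>Otherwise at most d < q - 1 powers of \<open>g\<close> would have to cover the
      q - 1 nonzero elements.\<close>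
    have "d = 0"
    proof (rule ccontr)
      assume "d \<noteq> 0"
      hence "F - {0} \<subseteq> (\<lambda>i. g ^ i) ` {..<d}"
        unfolding carr using mod_eq[OF d(1)] by (auto simp: image_iff) (metis lessThan_iff mod_less_divisor neq0_conv)
      hence "card (F - {0}) \<le> d"
        by (rule surj_card_le[OF finite_lessThan, simplified])
      moreover have "card (F - {0}) = q - 1"
        using cardF finF q_gt_1 by (simp add: F)
      ultimately show False using d(2) by linarith
    qed
    thus "(q - 1) dvd i" by (auto simp: d_def)
  next
    assume "(q - 1) dvd i"
    then obtain c where "i = (q - 1) * c" by (elim dvdE)
    thus "g ^ i = 1" by (simp only: power_mult g1 power_one)
  qed
  moreover have "\<exists>i. z = g ^ i" if "z ^ q = z" "z \<noteq> 0" for z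
  proof -
    have "z \<in> F - {0}" using that by (simp add: F)
    thus ?thesis unfolding carr by blast
  qed
  ultimately show ?thesis by blast
qed

end

section \<open>Powers detected by root multiplicities\<close>

lemma order_power_eq:
  fixes p :: "'a :: idom poly"
  assumes "p \<noteq> 0"
  shows "Polynomial.order x (p ^ n) = n * Polynomial.order x p"
  using assms by (induction n) (simp_all add: order_mult)

text \<open>The monic \<open>l\<close>-th root over the algebraic closure is unique, hence fixed by Frobenius.\<close>
lemma monic_power_of_orders:
  fixes a :: "'a :: {finite, field} poly"
  assumes "lead_coeff a = 1" and "l > 0" and "\<And>\<alpha>. l dvd Polynomial.order \<alpha> (map_poly to_ac a)"
  shows "\<exists>r. r ^ l = a"
proof -
  define q where "q = CARD('a)"
  interpret frobenius q "{} :: 'a alg_closure set"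
    unfolding q_def using frobenius_card_power[of 1 "{} :: 'a alg_closure set"] by simp
  have tq: "to_ac c ^ q = to_ac c" for c :: 'a
    unfolding q_def by (rule to_ac_power_card)
  define A where "A = map_poly to_ac a"
  define R where "R = {x. poly A x = 0}"
  have A1: "lead_coeff A = 1" unfolding A_def by (rule to_ac_hom.map_poly_hom_monic[OF assms(1)])
  hence "A \<noteq> 0" by auto
  hence finR: "finite R" by (simp add: R_def poly_roots_finite)
  \<comment> \<open>The root is built by dividing all root multiplicities by
    \<open>l\<close>.\<close>
  define G where "G = (\<Prod>x\<in>R. [:-x, 1:] ^ (Polynomial.order x A div l))"
  have "G ^ l = (\<Prod>x\<in>R. [:-x, 1:] ^ Polynomial.order x A)"
    unfolding G_def prod_power_distrib using assms(3) by (simp add: A_def flip: power_mult)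
  also have "\<dots> = A"
    by (rule monic_eq_prod_linear_powers[symmetric, OF A1 finR]) (simp add: R_def)
  finally have GA: "G ^ l = A" .
  have G1: "lead_coeff G = 1"
    unfolding G_def by (rule lead_coeff_prod_monic) (simp add: lead_coeff_power)
  define G' where "G' = map_poly (\<lambda>x. x ^ q) G"
  have G'1: "lead_coeff G' = 1" unfolding G'_def by (rule frob.map_poly_hom_monic[OF G1])
  have "map_poly (\<lambda>x. x ^ q) A = A"
    by (intro poly_eqI) (simp add: A_def tq)
  hence G'A: "G' ^ l = A" by (simp add: G'_def GA flip: frob.map_poly_hom_power)
  have nz: "G \<noteq> 0" "G' \<noteq> 0" using G1 G'1 by auto
  have "l * Polynomial.order x G = l * Polynomial.order x G'" for x
    using order_power_eq[OF nz(1), of x l] order_power_eq[OF nz(2), of x l] by (simp add: GA G'A)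
  hence ord: "Polynomial.order x G = Polynomial.order x G'" for x using assms(2) by simp
  have fin: "finite {x. poly G x = 0}" using nz by (simp add: poly_roots_finite)
  have "poly G' x = 0 \<longleftrightarrow> poly G x = 0" for x using ord[of x] nz by (simp add: order_root)
  hence "G' = G"
    using monic_eq_prod_linear_powers[OF G1 fin] monic_eq_prod_linear_powers[OF G'1 fin] ord by simp
  hence "coeff (map_poly (\<lambda>x. x ^ q) G) i = coeff G i" for i
    by (simp only: G'_def)
  hence "coeff G i \<in> subfld 1" for i by (simp add: subfld_def)
  \<comment> \<open>The copy of the base field has \<open>q\<close> elements and so exhausts the
    fixed field; this brings the coefficients of \<open>G\<close> down to the base field.\<close>
  moreover have "subfld 1 = range to_ac"
  proof (rule card_subset_eq[symmetric])
    show "range to_ac \<subseteq> subfld 1"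
      by (auto simp: subfld_def tq)
    show "card (range (to_ac :: 'a \<Rightarrow> _)) = card (subfld 1)"
      using card_subfld(2)[of 1] by (simp add: card_image inj_to_ac q_def)
  qed (use card_subfld(1)[of 1] in simp)
  ultimately have range: "coeff G i \<in> range to_ac" for i by blast
  define r where "r = map_poly of_ac G"
  have "map_poly to_ac r = G"
    by (intro poly_eqI) (simp add: r_def coeff_map_poly to_ac_of_ac range)
  hence "map_poly to_ac (r ^ l) = map_poly to_ac a"
    by (simp add: to_ac_hom.map_poly_hom_power GA A_def)
  hence "coeff (map_poly to_ac (r ^ l)) i = coeff (map_poly to_ac a) i" for i
    by (simp only:)
  hence "coeff (r ^ l) i = coeff a i" for i by simp
  thus ?thesis by (intro exI[of _ r] poly_eqI)
qed

lemma exists_order_not_dvd: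
  fixes a :: "'a :: {finite, field_gcd} poly"
  assumes "lead_coeff a = 1" and "l > 0" and "\<not> (\<exists>r :: 'a poly fract. r ^ l = to_fract a)"
  shows "\<exists>\<alpha>. poly (map_poly to_ac a) \<alpha> = 0 \<and> \<not> l dvd Polynomial.order \<alpha> (map_poly to_ac a)"
proof (rule ccontr)
  assume *: "\<not> ?thesis"
  have "l dvd Polynomial.order \<alpha> (map_poly to_ac a)" for \<alpha>
    using * by (cases "poly (map_poly to_ac a) \<alpha> = 0") (auto simp: order_0I)
  then obtain r where r: "r ^ l = a" using monic_power_of_orders[OF assms(1,2)] by blast
  have "to_fract (r ^ l) = to_fract r ^ l"
    by (induction l) simp_all
  thus False using assms(3) r by metis
qed

text \<open>The pairs orthogonal to all relations are closed under sums and multiples and contain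
  every (\<open>e \<alpha>\<close>, \<open>f \<alpha>\<close>). For each prime dividing
  \<open>m\<close> one of them has both entries prime to it; a combination in the style of the
  Chinese remainder theorem treats all primes at once.\<close>

lemma exists_coprime_combination:
  fixes e f :: "'b \<Rightarrow> nat"
  assumes "m > 0"
    and e: "\<And>l. prime l \<Longrightarrow> l dvd m \<Longrightarrow> \<exists>\<alpha>\<in>Z. \<not> l dvd e \<alpha>"
    and f: "\<And>l. prime l \<Longrightarrow> l dvd m \<Longrightarrow> \<exists>\<alpha>\<in>Z. \<not> l dvd f \<alpha>"
  shows "\<exists>x y. coprime x m \<and> coprime y m \<and>
           (\<forall>i j. (\<forall>\<alpha>\<in>Z. m dvd i * e \<alpha> + j * f \<alpha>) \<longrightarrow> m dvd i * x + j * y)"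
proof -
  define V where "V = (\<lambda>(x, y). \<forall>i j. (\<forall>\<alpha>\<in>Z. m dvd i * e \<alpha> + j * f \<alpha>) \<longrightarrow> m dvd i * x + j * y)"
  define \<P> where "\<P> = prime_factors m"
  have \<P>: "l \<in> \<P> \<longleftrightarrow> prime l \<and> l dvd m" for l using assms(1) by (auto simp: \<P>_def in_prime_factors_iff)
  have V_pt: "V (e \<alpha>, f \<alpha>)" if "\<alpha> \<in> Z" for \<alpha> using that by (auto simp: V_def)
  have V_add: "V (x + x', y + y')" if "V (x, y)" "V (x', y')" for x y x' y'
    unfolding V_def split
  proof (intro allI impI)
    fix i j assume "\<forall>\<alpha>\<in>Z. m dvd i * e \<alpha> + j * f \<alpha>"
    hence "m dvd i * x + j * y" "m dvd i * x' + j * y'" using that by (auto simp: V_def)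
    hence "m dvd (i * x + j * y) + (i * x' + j * y')" by (rule dvd_add)
    thus "m dvd i * (x + x') + j * (y + y')" by (simp add: algebra_simps)
  qed
  have V_mult: "V (u * x, u * y)" if "V (x, y)" for u x y
    unfolding V_def split
  proof (intro allI impI)
    fix i j assume "\<forall>\<alpha>\<in>Z. m dvd i * e \<alpha> + j * f \<alpha>"
    hence "m dvd i * x + j * y" using that by (auto simp: V_def)
    hence "m dvd u * (i * x + j * y)" by (rule dvd_mult)
    thus "m dvd i * (u * x) + j * (u * y)" by (simp add: algebra_simps)
  qed
  have "\<exists>p. V p \<and> \<not> l dvd fst p \<and> \<not> l dvd snd p" if "l \<in> \<P>" for l
  proof -
    obtain \<alpha> \<beta> where \<alpha>: "\<alpha> \<in> Z" "\<not> l dvd e \<alpha>" and \<beta>: "\<beta> \<in> Z" "\<not> l dvd f \<beta>"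
      using e f \<P> \<open>l \<in> \<P>\<close> by metis
    show ?thesis
    proof (cases "l dvd f \<alpha> \<and> l dvd e \<beta>")
      case True
      \<comment> \<open>If neither witness serves for both entries, their sum does.\<close>
      have "V (e \<alpha> + e \<beta>, f \<alpha> + f \<beta>)" using V_add V_pt \<alpha> \<beta> by blast
      moreover have "\<not> l dvd e \<alpha> + e \<beta>" "\<not> l dvd f \<alpha> + f \<beta>"
        using True \<alpha> \<beta> by (simp_all add: dvd_add_left_iff dvd_add_right_iff)
      ultimately show ?thesis by (metis fst_conv snd_conv)
    next
      case False
      thus ?thesis using V_pt \<alpha> \<beta> by (metis fst_conv snd_conv)
    qed
  qed
  then obtain p where p: "\<And>l. l \<in> \<P> \<Longrightarrow> V (p l)" "\<And>l. l \<in> \<P> \<Longrightarrow> \<not> l dvd fst (p l)" "\<And>l. l \<in> \<P> \<Longrightarrow> \<not> l dvd snd (p l)"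
    by metis
  \<comment> \<open>\<open>u l\<close> is divisible by every prime factor of \<open>m\<close> except
    \<open>l\<close>, so modulo \<open>l\<close> only the summand of \<open>l\<close>
    survives.\<close>
  define u where "u = (\<lambda>l. \<Prod>(\<P> - {l}))"
  have fin: "finite \<P>" by (simp add: \<P>_def)
  have coprime_sum: "coprime (\<Sum>l\<in>\<P>. u l * h l) m" if h: "\<And>l. l \<in> \<P> \<Longrightarrow> \<not> l dvd h l" for h
  proof (rule ccontr)
    assume "\<not> coprime (\<Sum>l\<in>\<P>. u l * h l) m"
    hence "gcd (\<Sum>l\<in>\<P>. u l * h l) m \<noteq> 1" by (simp add: coprime_iff_gcd_eq_1)
    then obtain l where "prime l" "l dvd gcd (\<Sum>l\<in>\<P>. u l * h l) m"
      using prime_factor_nat by blast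
    hence l: "prime l" "l dvd (\<Sum>l\<in>\<P>. u l * h l)" "l dvd m" by auto
    have "l \<in> \<P>" using l \<P> by simp
    have "l dvd u l' * h l'" if "l' \<in> \<P> - {l}" for l'
      unfolding u_def using that \<open>l \<in> \<P>\<close> fin by (intro dvd_mult2 dvd_prodI) auto
    hence "l dvd (\<Sum>l'\<in>\<P> - {l}. u l' * h l')" by (rule dvd_sum)
    hence "l dvd u l * h l"
      using l(2) \<open>l \<in> \<P>\<close> fin by (simp add: sum.remove dvd_add_left_iff)
    hence "l dvd u l" using h[OF \<open>l \<in> \<P>\<close>] l(1) prime_dvd_mult_iff by blast
    then obtain l' where "l' \<in> \<P> - {l}" "l dvd l'"
      unfolding u_def using l(1) fin by (auto simp: prime_dvd_prod_iff)
    thus False using l(1) \<P> by (metis DiffE insertI1 primes_dvd_imp_eq)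
  qed
  have "V (\<Sum>l\<in>B. u l * fst (p l), \<Sum>l\<in>B. u l * snd (p l))" if "B \<subseteq> \<P>" for B
  proof -
    have "finite B" using that fin finite_subset by blast
    thus ?thesis using that
    proof (induction B rule: finite_induct)
      case empty
      show ?case by (simp add: V_def)
    next
      case (insert l B)
      thus ?case using V_add[OF V_mult[of "fst (p l)" "snd (p l)" "u l"]] p(1)[of l] by simp
    qed
  qed
  hence "V (\<Sum>l\<in>\<P>. u l * fst (p l), \<Sum>l\<in>\<P>. u l * snd (p l))" by simp
  moreover have "coprime (\<Sum>l\<in>\<P>. u l * fst (p l)) m" "coprime (\<Sum>l\<in>\<P>. u l * snd (p l)) m"
    by (rule coprime_sum, rule p, assumption)+
  ultimately show ?thesis unfolding V_def split by (intro exI conjI)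
qed

section \<open>Common divisors of cyclotomic values\<close>

lemma power_minus_1_eq_geometric: "q ^ N - 1 = (q - 1) * (\<Sum>i<N. q ^ i)" for q :: nat
proof (induction N)
  case (Suc N)
  show ?case
  proof (cases "q = 0")
    case False
    hence "q ^ Suc N - 1 = (q - 1) * q ^ N + (q ^ N - 1)"
      by (simp add: diff_mult_distrib)
    thus ?thesis using Suc by (simp add: distrib_left)
  qed simp
qed simp

context kummer_character begin

text \<open>The counterpart of \<zeta> in GF(\<open>q\<close>): raising \<open>g ^ i\<close> to the
  power (q - 1)/m gives \<open>\<gamma> ^ i\<close>, whereas \<omega> sends it to
  \<open>\<zeta> ^ i\<close>.\<close>

definition \<gamma> :: 'k where "\<gamma> = g ^ ((q - 1) div m)"

lemma gamma_power_eq_1: "\<gamma> ^ i = 1 \<longleftrightarrow> m dvd i"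
proof -
  obtain t where t: "q - 1 = m * t" using m_dvd by (elim dvdE)
  hence "t > 0" using q_gt_1 by (cases t) auto
  thus ?thesis using m_pos unfolding \<gamma>_def power_mult[symmetric] g_power_eq_1 t by simp
qed

lemma gamma_power_cong:
  assumes "\<zeta> ^ i = \<zeta> ^ j"
  shows "\<gamma> ^ i = \<gamma> ^ j"
proof -
  have *: "\<gamma> ^ i = \<gamma> ^ j" if "\<zeta> ^ i = \<zeta> ^ j" "i \<le> j" for i j
  proof -
    have "\<zeta> ^ i * \<zeta> ^ (j - i) = \<zeta> ^ j" using that(2) by (simp flip: power_add)
    hence "\<zeta> ^ i * \<zeta> ^ (j - i) = \<zeta> ^ i * 1" using that(1) by simp
    hence "\<zeta> ^ (j - i) = 1" using zeta_nonzero by simp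
    hence "\<gamma> ^ (j - i) = 1" by (simp add: zeta_power_eq_1 gamma_power_eq_1)
    hence "\<gamma> ^ i * \<gamma> ^ (j - i) = \<gamma> ^ i" by simp
    thus ?thesis using that(2) by (simp flip: power_add)
  qed
  show ?thesis using *[of i j] *[of j i] assms by (metis nat_le_linear)
qed

text \<open>Up to sign, \<open>\<Prod>\<^sub>i (\<theta>^(q^i) - \<alpha>)\<close> is both the norm of \<open>\<theta> - \<alpha>\<close> and the value of
  the characteristic polynomial at \<open>\<alpha>\<close>.\<close>
lemma poly_power_of_character:
  assumes sign: "(- 1 :: 'k) ^ ((q - 1) div m) = 1"
    and p: "lead_coeff p = 1" "\<And>\<alpha>. poly p \<alpha> = 0 \<Longrightarrow> \<alpha> \<in> Z"
    and \<theta>: "\<theta> \<in> subfld N"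
    and \<chi>: "\<chi> (\<lambda>\<alpha>. Polynomial.order \<alpha> p) (charpoly N \<theta>) = \<zeta> ^ x"
  shows "poly p \<theta> ^ ((q ^ N - 1) div m) = \<gamma> ^ x"
proof -
  define e where "e = (\<lambda>\<alpha>. Polynomial.order \<alpha> p)"
  define t where "t = (q - 1) div m"
  define s where "s = (\<Sum>i<N. q ^ i)"
  define v where "v = (\<lambda>\<alpha>. poly (charpoly N \<theta>) \<alpha>)"
  have "q ^ N - 1 = m * (t * s)"
    unfolding power_minus_1_eq_geometric s_def t_def using m_dvd by (simp flip: mult.assoc)
  \<comment> \<open>The exponent \<open>s\<close> gives the norm down to GF(\<open>q\<close>); the
    power \<open>t\<close> then yields the residue symbol.\<close>
  hence exponent: "(q ^ N - 1) div m = s * t" using m_pos by simp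
  have frobZ: "\<alpha> ^ (q ^ i) = \<alpha>" if "\<alpha> \<in> Z" for \<alpha> i
    using Z_subset_subfld[of i] that by (auto simp: subfld_def)
  have norm: "((\<theta> - \<alpha>) ^ s) ^ t = v \<alpha> ^ t" if \<alpha>: "\<alpha> \<in> Z" for \<alpha>
  proof -
    have "(\<theta> - \<alpha>) ^ s = (\<Prod>i<N. (\<theta> - \<alpha>) ^ (q ^ i))"
      by (simp add: s_def power_sum)
    also have "\<dots> = (\<Prod>i<N. - 1 * (\<alpha> - \<theta> ^ (q ^ i)))"
      using frobZ[OF \<alpha>] by (simp add: coeff_hom.hom_diff[OF frob_power_hom])
    also have "\<dots> = (- 1) ^ N * v \<alpha>"
      unfolding prod.distrib by (simp add: v_def charpoly_def poly_prod)
    finally have "((\<theta> - \<alpha>) ^ s) ^ t = ((- 1) ^ t) ^ N * v \<alpha> ^ t"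
      by (simp add: power_mult_distrib mult.commute flip: power_mult)
    thus ?thesis using sign by (simp add: t_def)
  qed
  have nz: "v \<alpha> \<noteq> 0" if "\<alpha> \<in> Z" "e \<alpha> \<noteq> 0" for \<alpha>
  proof
    assume "v \<alpha> = 0"
    hence "\<chi> e (charpoly N \<theta>) = 0"
      using that finite_Z by (auto simp: \<chi>_def v_def intro!: bexI[of _ \<alpha>])
    thus False using \<chi> zeta_nonzero by (simp add: e_def)
  qed
  \<comment> \<open>Discrete logarithms are taken only where the exponent is positive:
    \<open>Z\<close> may contain points that are not roots of \<open>p\<close>, and there
    \<open>v\<close> may vanish.\<close>
  have "\<exists>i. e \<alpha> \<noteq> 0 \<longrightarrow> v \<alpha> = g ^ i" if "\<alpha> \<in> Z" for \<alpha>
    using nz[OF that] generator[of "v \<alpha>"] frob_poly_monics[OF charpoly_in_monics[OF \<theta>] that]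
    by (auto simp: v_def)
  then obtain i where i: "\<And>\<alpha>. \<alpha> \<in> Z \<Longrightarrow> e \<alpha> \<noteq> 0 \<Longrightarrow> v \<alpha> = g ^ i \<alpha>" by metis
  have "poly p \<theta> = (\<Prod>\<alpha>\<in>Z. (\<theta> - \<alpha>) ^ e \<alpha>)"
    using arg_cong[OF monic_eq_prod_linear_powers[OF p(1) finite_Z p(2)], of "\<lambda>p. poly p \<theta>"]
    by (simp add: poly_prod e_def)
  hence "poly p \<theta> ^ ((q ^ N - 1) div m) = (\<Prod>\<alpha>\<in>Z. ((\<theta> - \<alpha>) ^ e \<alpha>) ^ (s * t))"
    unfolding exponent by (simp only: prod_power_distrib)
  also have "\<dots> = (\<Prod>\<alpha>\<in>Z. \<gamma> ^ (i \<alpha> * e \<alpha>))"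
  proof (intro prod.cong refl)
    fix \<alpha> assume \<alpha>: "\<alpha> \<in> Z"
    have "((\<theta> - \<alpha>) ^ e \<alpha>) ^ (s * t) = (((\<theta> - \<alpha>) ^ s) ^ t) ^ e \<alpha>"
      by (simp add: mult_ac flip: power_mult)
    also have "\<dots> = (v \<alpha> ^ t) ^ e \<alpha>" by (simp only: norm[OF \<alpha>])
    also have "\<dots> = \<gamma> ^ (i \<alpha> * e \<alpha>)"
      using i[OF \<alpha>] by (cases "e \<alpha> = 0") (simp_all add: \<gamma>_def t_def mult_ac flip: power_mult)
    finally show "((\<theta> - \<alpha>) ^ e \<alpha>) ^ (s * t) = \<gamma> ^ (i \<alpha> * e \<alpha>)" .
  qed
  also have "\<dots> = \<gamma> ^ (\<Sum>\<alpha>\<in>Z. i \<alpha> * e \<alpha>)" by (simp add: power_sum)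
  also have "\<dots> = \<gamma> ^ x"
  proof (rule gamma_power_cong)
    have "\<zeta> ^ (\<Sum>\<alpha>\<in>Z. i \<alpha> * e \<alpha>) = (\<Prod>\<alpha>\<in>Z. \<omega> (v \<alpha>) ^ e \<alpha>)"
      unfolding power_sum
    proof (intro prod.cong refl)
      fix \<alpha> assume "\<alpha> \<in> Z"
      thus "\<zeta> ^ (i \<alpha> * e \<alpha>) = \<omega> (v \<alpha>) ^ e \<alpha>"
        using i by (cases "e \<alpha> = 0") (simp_all add: omega_power power_mult)
    qed
    also have "\<dots> = \<zeta> ^ x" using \<chi> by (simp add: \<chi>_def v_def e_def)
    finally show "\<zeta> ^ (\<Sum>\<alpha>\<in>Z. i \<alpha> * e \<alpha>) = \<zeta> ^ x" .
  qed
  finally show ?thesis .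
qed

lemma cyclotomic_root_gamma:
  assumes "coprime i m"
  shows "poly (cyclotomic m) (\<gamma> ^ i) = 0"
proof (rule cyclotomic_root[OF m_pos])
  show "(\<gamma> ^ i) ^ m = 1" by (simp add: gamma_power_eq_1 flip: power_mult)
  fix d assume d: "d dvd m" "(\<gamma> ^ i) ^ d = 1"
  hence "m dvd i * d" by (simp add: gamma_power_eq_1 flip: power_mult)
  hence "m dvd d" using assms by (simp add: coprime_dvd_mult_right_iff coprime_commute)
  thus "d = m" using d by (simp add: dvd_antisym)
qed

end

text \<open>A Bezout identity survives in the algebraic closure, so every common root is a root of
  the gcd.\<close>

lemma card_common_roots_le_degree_gcd:
  fixes p r :: "'a :: field_gcd poly"
  assumes "p \<noteq> 0"
    and "\<And>\<theta>. \<theta> \<in> T \<Longrightarrow> poly (map_poly to_ac p) \<theta> = 0 \<and> poly (map_poly to_ac r) \<theta> = 0"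
  shows "card T \<le> degree (gcd p r)"
proof -
  obtain u v where "u * p + v * r = gcd p r"
    using bezout_coefficients[of p r] by (metis surj_pair)
  hence "map_poly to_ac (gcd p r) = map_poly to_ac u * map_poly to_ac p + map_poly to_ac v * map_poly to_ac r"
    by (metis to_ac_hom.map_poly_hom_add to_ac_hom.map_poly_hom_mult)
  hence sub: "T \<subseteq> {\<theta>. poly (map_poly to_ac (gcd p r)) \<theta> = 0}"
    using assms(2) by auto
  have "gcd p r \<noteq> 0" using assms(1) by simp
  hence nz: "map_poly to_ac (gcd p r) \<noteq> 0" by (subst map_poly_eq_0_iff) auto
  have "card T \<le> card {\<theta>. poly (map_poly to_ac (gcd p r)) \<theta> = 0}"
    using sub nz by (intro card_mono poly_roots_finite)
  also have "\<dots> \<le> degree (map_poly to_ac (gcd p r))" by (rule card_poly_roots_bound[OF nz])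
  also have "\<dots> = degree (gcd p r)" by (rule degree_map_poly) auto
  finally show ?thesis .
qed

lemma map_poly_to_ac_cyclotomic: "map_poly to_ac (cyclotomic m) = cyclotomic m"
  by (intro poly_eqI) (simp add: cyclotomic_def)

lemma common_splitting_field:
  fixes R :: "'a :: {finite, field} alg_closure set" and m :: nat
  assumes "finite R" and "m > 0" and "coprime m CARD('a)"
    and R: "\<And>\<alpha>. \<alpha> \<in> R \<Longrightarrow> \<exists>p :: 'a poly. lead_coeff p = 1 \<and> poly (map_poly to_ac p) \<alpha> = 0"
  shows "\<exists>M>0. (\<forall>\<alpha>\<in>R. \<alpha> ^ (CARD('a) ^ M) = \<alpha>) \<and> m dvd CARD('a) ^ M - 1 \<and>
           (- 1 :: 'a alg_closure) ^ ((CARD('a) ^ M - 1) div m) = 1"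
proof -
  define q where "q = CARD('a)"
  interpret frobenius q "{} :: 'a alg_closure set"
    unfolding q_def using frobenius_card_power[of 1 "{} :: 'a alg_closure set"] by simp
  have "\<exists>e>0. \<alpha> \<in> subfld e" if "\<alpha> \<in> R" for \<alpha>
  proof -
    obtain p :: "'a poly" where p: "lead_coeff p = 1" "poly (map_poly to_ac p) \<alpha> = 0"
      using R \<open>\<alpha> \<in> R\<close> by blast
    have "to_ac c ^ q = to_ac c" for c :: 'a
      unfolding q_def by (rule to_ac_power_card)
    hence "map_poly (\<lambda>x. x ^ q) (map_poly to_ac p) = map_poly to_ac p"
      by (intro poly_eqI) simp
    hence "map_poly to_ac p \<in> monics (degree p)"
      using to_ac_hom.map_poly_hom_monic[OF p(1)] by (simp add: monics_def)
    thus ?thesis using root_in_subfld p(2) by blast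
  qed
  then obtain e where e: "\<And>\<alpha>. \<alpha> \<in> R \<Longrightarrow> e \<alpha> > 0 \<and> \<alpha> \<in> subfld (e \<alpha>)" by metis
  \<comment> \<open>The factor \<open>totient m\<close> yields m | q^h - 1 by Euler's theorem; the
    product makes \<open>h\<close> a multiple of every \<open>e \<alpha>\<close>.\<close>
  define h where "h = totient m * (\<Prod>\<alpha>\<in>R. e \<alpha>)"
  \<comment> \<open>Doubling makes (q^M - 1)/m divisible by q^h + 1, which is even for odd
    \<open>q\<close>; for even \<open>q\<close> the sign is trivial.\<close>
  define M where "M = h * 2"
  have h: "h > 0" unfolding h_def using assms(2) e by (auto intro!: prod_pos)
  have "\<alpha> ^ (q ^ M) = \<alpha>" if "\<alpha> \<in> R" for \<alpha>
  proof -
    have "e \<alpha> dvd M" unfolding M_def h_def using that assms(1) by (intro dvd_mult2 dvd_mult dvd_prodI) 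
    then obtain k where "M = e \<alpha> * k" by (elim dvdE)
    thus ?thesis using frob_power_period[of \<alpha> "e \<alpha>" k] e[OF that] by simp
  qed
  moreover have "m dvd q ^ h - 1"
  proof -
    have "[q ^ totient m = 1] (mod m)"
      using assms(3) by (intro euler_theorem) (simp add: q_def coprime_commute)
    hence "[(q ^ totient m) ^ (\<Prod>\<alpha>\<in>R. e \<alpha>) = 1 ^ (\<Prod>\<alpha>\<in>R. e \<alpha>)] (mod m)"
      by (rule cong_pow)
    hence "[q ^ h = 1] (mod m)" by (simp add: h_def power_mult)
    thus ?thesis using cong_altdef_nat[of 1 "q ^ h" m] q_gt_1 by (auto simp: cong_sym_eq)
  qed
  then obtain c where c: "q ^ h - 1 = m * c" by (elim dvdE)
  have "q ^ M - 1 = (q ^ h - 1) * (q ^ h + 1)"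
    by (simp add: M_def power_mult power2_eq_square algebra_simps)
  hence fac: "q ^ M - 1 = m * (c * (q ^ h + 1))" unfolding c by (simp only: mult.assoc)
  have "(- 1 :: 'a alg_closure) ^ ((q ^ M - 1) div m) = 1"
  proof (cases "even q")
    case True
    have "(- 1 :: 'a alg_closure) ^ q = - 1" by (simp add: frob.hom_uminus)
    hence "(1 :: 'a alg_closure) = - 1" using True by simp
    thus ?thesis by (metis power_one)
  next
    case False
    hence "even (c * (q ^ h + 1))" by simp
    thus ?thesis unfolding fac using assms(2) by simp
  qed
  ultimately show ?thesis
    using h fac unfolding q_def[symmetric] by (intro exI[of _ M]) (simp add: M_def)
qed

text \<open>If n = t (q^(M N) - 1)/m and q^k divides q^(M N), then m n is congruent to -t modulo
  q^k, which explains the residue. Taking \<open>t\<close> to be 1 modulo \<open>m\<close> makes it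
  prime to \<open>m\<close>; the shift by \<open>m * Q\<close> ensures t > 0.\<close>

lemma exists_congruent_coprime_multiplier:
  fixes n0 :: int and m Q :: nat
  assumes "m > 0" "Q > 0" "coprime m Q"
  shows "\<exists>t>0. t \<le> 2 * m * Q \<and> coprime t m \<and> [int t = - int m * n0] (mod int Q)"
proof -
  define r where "r = nat ((- int m * n0) mod int Q)"
  obtain x where x: "x < m * Q" "[x = 1] (mod m)" "[x = r] (mod Q)"
    using binary_chinese_remainder_unique_nat[OF assms(3), of 1 r] assms by auto
  have "[x + m * Q = 1] (mod m)" using x(2) by (simp add: cong_def)
  hence "coprime (x + m * Q) m" by (metis cong_imp_coprime cong_sym coprime_1_left)
  moreover have "[x + m * Q = r] (mod Q)" using x(3) by (simp add: cong_def)
  hence "[int (x + m * Q) = int r] (mod int Q)" by (simp only: cong_int_iff)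
  hence "[int (x + m * Q) = - int m * n0] (mod int Q)"
    using assms by (simp add: r_def cong_def)
  moreover have "x + m * Q \<le> 2 * m * Q" "x + m * Q > 0" using x(1) assms(1,2) by (simp_all add: mult_ac)
  ultimately show ?thesis by blast
qed

theorem theorem3p1:
  fixes a b :: "'a::{finite,field_gcd} poly" and m k :: nat
  assumes "m > 0"
    and "coprime m (CARD('a))"
    and "lead_coeff a = 1" and "degree a > 0"
    and "lead_coeff b = 1" and "degree b > 0"
    and "\<forall>l. prime l \<and> l dvd m \<longrightarrow> \<not> (\<exists>r :: 'a poly fract. r ^ l = to_fract a)"
    and "\<forall>l. prime l \<and> l dvd m \<longrightarrow> \<not> (\<exists>r :: 'a poly fract. r ^ l = to_fract b)"
  shows "\<exists>c::real > 0. \<forall>n0::int.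
           infinite {n::nat. n > 0 \<and> [int n = n0] (mod int (CARD('a) ^ k)) \<and>
             real (degree (gcd (pcompose (cyclotomic m) (a ^ n))
                               (pcompose (cyclotomic m) (b ^ n)))) \<ge> c * real n}"
proof -
  define q where "q = CARD('a)"
  define A where "A = map_poly to_ac a"
  define B where "B = map_poly to_ac b"
  \<comment> \<open>Both root sets are joined so that both characters live on the same set, where
    \<open>e \<alpha> + f \<alpha>\<close> is then positive.\<close>
  define R where "R = {\<alpha>. poly A \<alpha> = 0 \<or> poly B \<alpha> = 0}"
  have monic: "lead_coeff A = 1" "lead_coeff B = 1"
    unfolding A_def B_def by (rule to_ac_hom.map_poly_hom_monic, fact)+
  hence nz: "A \<noteq> 0" "B \<noteq> 0" by auto
  have finR: "finite R"
    unfolding R_def Collect_disj_eq using nz by (simp add: poly_roots_finite)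
  have "\<exists>p :: 'a poly. lead_coeff p = 1 \<and> poly (map_poly to_ac p) \<alpha> = 0" if "\<alpha> \<in> R" for \<alpha>
    using that assms(3,5) unfolding R_def A_def B_def by blast
  from common_splitting_field[OF finR assms(1,2) this]
  obtain M where M: "M > 0" "\<And>\<alpha>. \<alpha> \<in> R \<Longrightarrow> \<alpha> ^ (q ^ M) = \<alpha>" "m dvd q ^ M - 1"
    and sign: "(- 1 :: 'a alg_closure) ^ ((q ^ M - 1) div m) = 1"
    unfolding q_def by blast
  define Q where "Q = q ^ M"
  interpret frobenius Q R
    unfolding Q_def q_def using M finR by (intro frobenius_card_power) (auto simp: q_def)
  obtain g :: "'a alg_closure" where g: "\<And>z. z ^ Q = z \<Longrightarrow> z \<noteq> 0 \<Longrightarrow> \<exists>i :: nat. z = g ^ i"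
      "\<And>i :: nat. g ^ i = 1 \<longleftrightarrow> (Q - 1) dvd i"
    using exists_generator by blast
  interpret kummer_character Q R m g
    by standard (use assms(1) M(3) g in \<open>auto simp: Q_def\<close>)
  define e where "e = (\<lambda>\<alpha>. Polynomial.order \<alpha> A)"
  define f where "f = (\<lambda>\<alpha>. Polynomial.order \<alpha> B)"
  have "\<exists>\<alpha>\<in>R. \<not> l dvd e \<alpha>" if "prime l" "l dvd m" for l
    using exists_order_not_dvd[of a l] assms(3,7) that prime_gt_0_nat[of l]
    by (auto simp: R_def e_def A_def)
  moreover have "\<exists>\<alpha>\<in>R. \<not> l dvd f \<alpha>" if "prime l" "l dvd m" for l
    using exists_order_not_dvd[of b l] assms(5,8) that prime_gt_0_nat[of l]
    by (auto simp: R_def f_def B_def)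
  ultimately obtain x y where xy: "coprime x m" "coprime y m"
    and ann: "\<And>i j. (\<forall>\<alpha>\<in>R. m dvd i * e \<alpha> + j * f \<alpha>) \<Longrightarrow> m dvd i * x + j * y"
    using exists_coprime_combination[OF assms(1), of R e f] by blast
  define G where "G = (\<lambda>N. {\<theta> \<in> subfld N. \<chi> e (charpoly N \<theta>) = \<zeta> ^ x \<and> \<chi> f (charpoly N \<theta>) = \<zeta> ^ y})"
  have "e \<alpha> + f \<alpha> > 0" if "\<alpha> \<in> R" for \<alpha>
    using that nz by (auto simp: R_def e_def f_def order_root)
  from infinitely_many_prescribed_values[of e f, OF this ann]
  have inf: "\<exists>\<^sub>\<infinity>N. real (card (G N)) \<ge> real Q ^ N / (2 * real m ^ 2)"
    unfolding G_def by blast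
  \<comment> \<open>There will be at least Q^N / (2 m^2) common roots while n is at most 2 q^k Q^N;
    the quotient of these bounds is \<open>c\<close>, independent of \<open>n0\<close>.\<close>
  define c where "c = 1 / (4 * real m ^ 2 * real (q ^ k))"
  have q0: "q > 0" by (simp add: q_def)
  have "c > 0" using assms(1) q0 by (simp add: c_def)
  moreover have "infinite {n::nat. n > 0 \<and> [int n = n0] (mod int (q ^ k)) \<and>
             real (degree (gcd (pcompose (cyclotomic m) (a ^ n))
                               (pcompose (cyclotomic m) (b ^ n)))) \<ge> c * real n}" (is "infinite ?S") for n0
    unfolding infinite_nat_iff_unbounded
  proof
    fix W :: nat
    obtain t where t: "t > 0" "t \<le> 2 * m * q ^ k" "coprime t m" "[int t = - int m * n0] (mod int (q ^ k))"
      using exists_congruent_coprime_multiplier[of m "q ^ k" n0] assms(1,2) q0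
      by (auto simp: q_def coprime_power_right_iff)
    \<comment> \<open>The summand \<open>k\<close> makes q^k divide Q^N, and \<open>m * W\<close>
      forces n > W.\<close>
    obtain N where N: "N > k + m * W" "real (card (G N)) \<ge> real Q ^ N / (2 * real m ^ 2)"
      using inf unfolding INFM_nat by blast
    define E where "E = (Q ^ N - 1) div m"
    define n where "n = t * E"
    have "m dvd Q ^ N - 1"
      unfolding power_minus_1_eq_geometric using m_dvd by (rule dvd_mult2)
    hence mE: "m * E = Q ^ N - 1" by (simp add: E_def)
    have "N < Q ^ N" using q_gt_1 less_exp[of N] power_mono[of 2 Q N] by linarith
    hence "m * E \<ge> N" using mE by linarith
    hence "m * E > m * W" using N(1) by linarith
    hence E: "E > W" by simp
    have "n \<ge> E" using t(1) by (simp add: n_def)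
    hence nW: "n > W" using E by linarith
    have cong: "[int n = n0] (mod int (q ^ k))"
    proof -
      have "k \<le> M * N" using N(1) M(1) by (cases M) auto
      hence "int (q ^ k) dvd int (Q ^ N)"
        unfolding Q_def power_mult[symmetric] by (simp add: le_imp_power_dvd)
      moreover have "Q ^ N \<ge> 1" using q_gt_1 by simp
      hence "m * E + 1 = Q ^ N" using mE by simp
      hence "t * (m * E + 1) = t * Q ^ N" by simp
      hence "m * n + t = t * Q ^ N" by (simp add: n_def algebra_simps)
      hence "int m * int n + int t = int t * int (Q ^ N)"
        by (metis of_nat_add of_nat_mult)
      ultimately have "[int m * int n + int t = 0] (mod int (q ^ k))"
        by (simp add: cong_0_iff)
      moreover have "[int m * int n + int t = int m * int n + (- int m * n0)] (mod int (q ^ k))"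
        using t(4) by (intro cong_add) auto
      ultimately have "[int m * int n - int m * n0 = 0] (mod int (q ^ k))"
        by (metis (no_types, lifting) cong_sym cong_trans diff_conv_add_uminus mult_minus_left)
      hence "[int m * int n = int m * n0] (mod int (q ^ k))"
        by (simp add: cong_diff_iff_cong_0)
      moreover have "coprime (int m) (int (q ^ k))"
        using assms(2) by (simp add: q_def coprime_power_right_iff)
      ultimately show ?thesis by (simp add: cong_mult_lcancel)
    qed
    have "card (G N) \<le> degree (gcd (pcompose (cyclotomic m) (a ^ n)) (pcompose (cyclotomic m) (b ^ n)))"
    proof (rule card_common_roots_le_degree_gcd)
      have "a \<noteq> 0" using assms(3) by auto
      hence "degree (a ^ n) > 0" using assms(4) nW by (simp add: degree_power_eq)
      moreover have "cyclotomic m \<noteq> (0 :: 'a poly)"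
        using cyclotomic_monic[OF assms(1), where ?'a = 'a] by auto
      ultimately show "pcompose (cyclotomic m) (a ^ n) \<noteq> 0"
        using pcompose_eq_0 by blast
      fix \<theta> assume \<theta>: "\<theta> \<in> G N"
      have "poly A \<theta> ^ E = \<gamma> ^ x"
        unfolding E_def using \<theta> sign monic
        by (intro poly_power_of_character) (auto simp: G_def e_def Q_def R_def)
      moreover have "poly B \<theta> ^ E = \<gamma> ^ y"
        unfolding E_def using \<theta> sign monic
        by (intro poly_power_of_character) (auto simp: G_def f_def Q_def R_def)
      \<comment> \<open>As x t and y t are prime to \<open>m\<close>, these are primitive m-th roots
        of unity, hence roots of the cyclotomic polynomial.\<close>
      ultimately have "poly A \<theta> ^ n = \<gamma> ^ (x * t)" "poly B \<theta> ^ n = \<gamma> ^ (y * t)"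
        by (simp_all add: n_def mult.commute[of t] power_mult)
      moreover have "coprime (x * t) m" "coprime (y * t) m" using xy t(3) by simp_all
      ultimately show "poly (map_poly to_ac (pcompose (cyclotomic m) (a ^ n))) \<theta> = 0 \<and>
          poly (map_poly to_ac (pcompose (cyclotomic m) (b ^ n))) \<theta> = 0"
        by (simp add: to_ac_hom.map_poly_hom_pcompose map_poly_to_ac_cyclotomic poly_pcompose
            to_ac_hom.map_poly_hom_power cyclotomic_root_gamma flip: A_def B_def)
    qed
    moreover have "c * real n \<le> real Q ^ N / (2 * real m ^ 2)"
    proof -
      have "m * n \<le> (2 * m * q ^ k) * Q ^ N"
        using mult_le_mono[OF t(2), of "m * E" "Q ^ N"] mE by (simp add: n_def mult_ac)
      hence "n \<le> 2 * q ^ k * Q ^ N" using assms(1) by simp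
      hence "real n \<le> 2 * real (q ^ k) * real Q ^ N"
        by (metis of_nat_le_iff of_nat_mult of_nat_numeral of_nat_power)
      hence "c * real n \<le> c * (2 * real (q ^ k) * real Q ^ N)"
        using \<open>c > 0\<close> by (intro mult_left_mono) auto
      also have "\<dots> = real Q ^ N / (2 * real m ^ 2)"
        using q0 assms(1) by (simp add: c_def field_simps)
      finally show ?thesis .
    qed
    ultimately have "n \<in> ?S" using nW cong N(2) by auto
    thus "\<exists>n>W. n \<in> ?S" using nW by blast
  qed
  ultimately show ?thesis unfolding q_def by blast
qed

end
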